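(* Let $p$ be a prime, $1\le r\le q<\infty$, $\beta\in[0,1)$, $\alpha\in(0,\infty)$ and $\mu\in\mathbb{R}$. For $s\in\mathbb{Q}_p^*$ define the $p$-adic Hadamard-type fractional integral operators $$(\mathcal{J}^{\alpha}_{0+,\mu}f)(s)=\frac{1}{\Gamma(\alpha)}\int_{\{t\in\mathbb{Q}_p^*:\,|t|_p<|s|_p\}}\left(\frac{|t|_p}{|s|_p}\right)^{\mu}\left(\log\frac{|s|_p}{|t|_p}\right)^{\alpha-1}\frac{1}{|t|_p}f(t)\,dt,$$ $$(\mathcal{J}^{\alpha}_{-,\mu}f)(s)=\frac{1}{\Gamma(\alpha)}\int_{\{t\in\mathbb{Q}_p^*:\,|t|_p>|s|_p\}}\left(\frac{|s|_p}{|t|_p}\right)^{\mu}\left(\log\frac{|t|_p}{|s|_p}\right)^{\alpha-1}\frac{1}{|t|_p}f(t)\,dt,$$ $$(\mathcal{I}^{\alpha}_{0+,\mu}f)(s)=\frac{1}{\Gamma(\alpha)}\int_{\{t\in\mathbb{Q}_p^*:\,|t|_p<|s|_p\}}\left(\frac{|t|_p}{|s|_p}\right)^{\mu}\left(\log\frac{|s|_p}{|t|_p}\right)^{\alpha-1}\frac{1}{|s|_p}f(t)\,dt,$$ $$(\mathcal{I}^{\alpha}_{-,\mu}f)(s)=\frac{1}{\Gamma(\alpha)}\int_{\{t\in\mathbb{Q}_p^*:\,|t|_p>|s|_p\}}\left(\frac{|s|_p}{|t|_p}\right)^{\mu}\left(\log\frac{|t|_p}{|s|_p}\right)^{\alpha-1}\frac{1}{|s|_p}f(t)\,dt.$$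 (a) If $\mu>\beta+\frac1q$, then $\mathcal{J}^{\alpha}_{0+,\mu}$ is bounded on $C^{\beta}M_{r,q}(\mathbb{Q}_p)$. (b) If $\mu>-\beta-\frac1q$, then $\mathcal{J}^{\alpha}_{-,\mu}$ is bounded on $C^{\beta}M_{r,q}(\mathbb{Q}_p)$. (c) If $\mu>\beta+\frac1q-1$, then $\mathcal{I}^{\alpha}_{0+,\mu}$ is bounded on $C^{\beta}M_{r,q}(\mathbb{Q}_p)$. (d) If $\mu>1-\beta-\frac1q$, then $\mathcal{I}^{\alpha}_{-,\mu}$ is bounded on $C^{\beta}M_{r,q}(\mathbb{Q}_p)$.
   Context: $\mathbb{Q}_p$ is the field of $p$-adic numbers with the $p$-adic absolute value $|\cdot|_p$, $\mathbb{Q}_p^*=\mathbb{Q}_p\setminus\{0\}$, and $dx$ is the Haar measure on $(\mathbb{Q}_p,+)$ normalized so that $\{x:|x|_p\le 1\}$ has measure $1$; $|E|$ denotes the measure of $E$. $\Gamma$ is the Euler Gamma function and $\log$ the natural logarithm. For $a\in\mathbb{Q}_p$, $\ell\in\mathbb{Z}$, let $B^\ell(a)=\{x\in\mathbb{Q}_p:|x-a|_p\le p^\ell\}$, so $|B^\ell(a)|=p^\ell$. For $1\le r\le q<\infty$ and $0\le\beta<1$, the fractional Cesàro–Morrey space $C^{\beta}M_{r,q}(\mathbb{Q}_p)$ consists of all locally integrable functions $f$ on $\mathbb{Q}_p$ with $\|f\|_{C^{\beta}M_{r,q}(\mathbb{Q}_p)}<\infty$, where for measurable $f$ (with values in $[0,\infty]$)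 $$\|f\|_{C^{\beta}M_{r,q}(\mathbb{Q}_p)}=\sup_{a\in\mathbb{Q}_p,\ \ell\in\mathbb{Z}}|B^\ell(a)|^{\frac1q-\frac1r}\left(\int_{B^\ell(a)}\left(\frac{1}{|x|_p^{1-\beta}}\int_{|t|_p\le|x|_p}|f(t)|\,dt\right)^r dx\right)^{1/r}.$$ An operator $T$ is bounded on $C^{\beta}M_{r,q}(\mathbb{Q}_p)$ if there is a constant $C>0$ with $\|Tf\|_{C^{\beta}M_{r,q}(\mathbb{Q}_p)}\le C\|f\|_{C^{\beta}M_{r,q}(\mathbb{Q}_p)}$ for all $f\in C^{\beta}M_{r,q}(\mathbb{Q}_p)$. *)

theory Defs
  imports "HOL-Analysis.Analysis" "Berlekamp_Zassenhaus.Finite_Field"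
begin

section \<open>The \<open>p\<close>-adic absolute value on the rationals\<close>

definition padic_abs :: "nat \<Rightarrow> rat \<Rightarrow> real" where
  "padic_abs p x = (if x = 0 then 0 else
     real p powi (int (multiplicity (int p) (snd (quotient_of x))) -
                  int (multiplicity (int p) (fst (quotient_of x)))))"

lemma padic_abs_0 [simp]: "padic_abs p 0 = 0"
  by (simp add: padic_abs_def)

lemma padic_abs_nonneg [simp]: "0 \<le> padic_abs p x"
  by (simp add: padic_abs_def zero_le_power_int)

lemma padic_abs_of_int_divide:
  assumes "prime p" "a \<noteq> 0" "b \<noteq> 0"
  shows "padic_abs p (of_int a / of_int b) =
           real p powi (int (multiplicity (int p) b) - int (multiplicity (int p) a))"
proof -
  define x :: rat where "x = of_int a / of_int b"
  obtain n d where q: "quotient_of x = (n, d)" by force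
  have d: "d > 0" using quotient_of_denom_pos[OF q] .
  have xn: "x = of_int n / of_int d" using quotient_of_div[OF q] .
  have n: "n \<noteq> 0" using assms xn by (auto simp: x_def)
  have "(of_int (a * d) :: rat) = of_int (n * b)"
    using xn assms d by (simp add: x_def field_simps)
  then have eq: "a * d = n * b" by linarith
  have pe: "prime_elem (int p)" using assms by simp
  have "multiplicity (int p) a + multiplicity (int p) d = multiplicity (int p) n + multiplicity (int p) b"
    using arg_cong[OF eq, of "multiplicity (int p)"] assms n d
    by (simp add: prime_elem_multiplicity_mult_distrib[OF pe])
  then have "int (multiplicity (int p) d) - int (multiplicity (int p) n) =
             int (multiplicity (int p) b) - int (multiplicity (int p) a)" by linarith
  moreover have "x \<noteq> 0" using assms by (simp add: x_def)
  ultimately show ?thesis unfolding x_def[symmetric] by (simp add: padic_abs_def q)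
qed

lemma padic_abs_eq_0_iff [simp]:
  assumes "prime p" shows "padic_abs p x = 0 \<longleftrightarrow> x = 0"
  using prime_gt_0_nat[OF assms] by (simp add: padic_abs_def)

lemma rat_of_int_divide_cases:
  obtains a b :: int where "x = (of_int a / of_int b :: rat)" "b \<noteq> 0"
proof (cases x)
  case (Fract a b)
  then show ?thesis using that[of a b] by (simp add: Fract_of_int_quotient)
qed

lemma padic_abs_mult:
  assumes "prime p" shows "padic_abs p (x * y) = padic_abs p x * padic_abs p y"
proof (cases "x = 0 \<or> y = 0")
  case False
  obtain a b where x: "x = of_int a / of_int b" "b \<noteq> 0" by (rule rat_of_int_divide_cases)
  obtain c d where y: "y = of_int c / of_int d" "d \<noteq> 0" by (rule rat_of_int_divide_cases)
  have ac: "a \<noteq> 0" "c \<noteq> 0" using False x y by auto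
  have pe: "prime_elem (int p)" using assms by simp
  have p: "real p \<noteq> 0" using prime_gt_0_nat[OF assms] by simp
  have "x * y = of_int (a * c) / of_int (b * d)" by (simp add: x y)
  then have "padic_abs p (x * y) = real p powi (int (multiplicity (int p) (b * d)) - int (multiplicity (int p) (a * c)))"
    using padic_abs_of_int_divide[OF assms, of "a * c" "b * d"] ac x y by simp
  also have "\<dots> = real p powi ((int (multiplicity (int p) b) - int (multiplicity (int p) a)) +
                             (int (multiplicity (int p) d) - int (multiplicity (int p) c)))"
    using ac x y by (simp add: prime_elem_multiplicity_mult_distrib[OF pe] algebra_simps)
  also have "\<dots> = padic_abs p x * padic_abs p y"
    using p padic_abs_of_int_divide[OF assms] ac x y by (simp add: power_int_add)
  finally show ?thesis .
qed auto

lemma padic_abs_1 [simp]: "prime p \<Longrightarrow> padic_abs p 1 = 1"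
  using padic_abs_of_int_divide[of p 1 1] by simp

lemma padic_abs_minus [simp]: "padic_abs p (- x) = padic_abs p x"
proof -
  have "quotient_of (- x) = (- fst (quotient_of x), snd (quotient_of x))"
    by (simp add: rat_uminus_code split: prod.split)
  moreover have "multiplicity (int p) (- a) = multiplicity (int p) a" for a
    using multiplicity_normalize_right[of "int p" a] multiplicity_normalize_right[of "int p" "- a"]
    by (simp del: multiplicity_normalize_right)
  ultimately show ?thesis by (simp add: padic_abs_def)
qed

lemma padic_abs_minus_commute: "padic_abs p (x - y) = padic_abs p (y - x)"
  using padic_abs_minus[of p "x - y"] by simp

lemma padic_abs_inverse:
  assumes "prime p" shows "padic_abs p (inverse x) = inverse (padic_abs p x)"
proof (cases "x = 0")
  case False
  have "padic_abs p x * padic_abs p (inverse x) = 1"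
    using False assms by (simp flip: padic_abs_mult)
  then show ?thesis by (metis inverse_unique)
qed auto

lemma padic_abs_ultra:
  assumes "prime p" shows "padic_abs p (x + y) \<le> max (padic_abs p x) (padic_abs p y)"
proof (cases "x = 0 \<or> y = 0 \<or> x + y = 0")
  case False
  obtain a b where x: "x = of_int a / of_int b" "b \<noteq> 0" by (rule rat_of_int_divide_cases)
  obtain c d where y: "y = of_int c / of_int d" "d \<noteq> 0" by (rule rat_of_int_divide_cases)
  have x': "x = of_int (a * d) / of_int (b * d)" and y': "y = of_int (c * b) / of_int (b * d)"
    using x y by simp_all
  have s': "x + y = of_int (a * d + c * b) / of_int (b * d)"
    unfolding x' y' by (simp add: add_divide_distrib)
  have nz: "a * d \<noteq> 0" "c * b \<noteq> 0" "a * d + c * b \<noteq> 0" "b * d \<noteq> 0"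
    using False x y s' by (auto simp del: of_int_add of_int_mult)
  let ?m = "multiplicity (int p)"
  have nu: "\<not> is_unit (int p)" using assms prime_gt_1_nat[OF assms] by simp
  have "int p ^ min (?m (a * d)) (?m (c * b)) dvd a * d + c * b"
    by (intro dvd_add multiplicity_dvd') auto
  then have ge: "?m (a * d + c * b) \<ge> min (?m (a * d)) (?m (c * b))"
    using nz nu by (intro multiplicity_geI) auto
  have p: "real p \<ge> 1" using prime_ge_1_nat[OF assms] by simp
  have eqs: "padic_abs p x = real p powi (int (?m (b * d)) - int (?m (a * d)))"
    using padic_abs_of_int_divide[OF assms nz(1,4)] by (simp only: x'[symmetric])
  have eqs2: "padic_abs p y = real p powi (int (?m (b * d)) - int (?m (c * b)))"
    using padic_abs_of_int_divide[OF assms nz(2,4)] by (simp only: y'[symmetric])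
  have eqs3: "padic_abs p (x + y) = real p powi (int (?m (b * d)) - int (?m (a * d + c * b)))"
    using padic_abs_of_int_divide[OF assms nz(3,4)] by (simp only: s'[symmetric])
  show ?thesis
  proof (cases "?m (a * d) \<le> ?m (c * b)")
    case True
    then have "padic_abs p (x + y) \<le> padic_abs p x"
      unfolding eqs eqs2 eqs3 using ge p by (intro power_int_increasing) auto
    then show ?thesis by simp
  next
    case False
    then have "padic_abs p (x + y) \<le> padic_abs p y"
      unfolding eqs eqs2 eqs3 using ge p by (intro power_int_increasing) auto
    then show ?thesis by simp
  qed
qed (auto simp: max_def)

lemma padic_abs_triangle:
  assumes "prime p" shows "padic_abs p (x + y) \<le> padic_abs p x + padic_abs p y"
  using padic_abs_ultra[OF assms, of x y] padic_abs_nonneg[of p x] padic_abs_nonneg[of p y] by linarith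

lemma padic_abs_diff_triangle:
  assumes "prime p" shows "\<bar>padic_abs p x - padic_abs p y\<bar> \<le> padic_abs p (x - y)"
  using padic_abs_triangle[OF assms, of "x - y" y] padic_abs_triangle[OF assms, of "y - x" x]
    padic_abs_minus_commute[of p x y] by simp


section \<open>Completion\<close>

definition padic_cauchy :: "nat \<Rightarrow> (nat \<Rightarrow> rat) \<Rightarrow> bool" where
  "padic_cauchy p X \<longleftrightarrow> (\<forall>e>0. \<exists>k. \<forall>m\<ge>k. \<forall>n\<ge>k. padic_abs p (X m - X n) < e)"

definition padic_null :: "nat \<Rightarrow> (nat \<Rightarrow> rat) \<Rightarrow> bool" where
  "padic_null p X \<longleftrightarrow> (\<lambda>n. padic_abs p (X n)) \<longlonglongrightarrow> 0"

lemma padic_cauchy_const [simp]: "padic_cauchy p (\<lambda>_. c)"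
  by (simp add: padic_cauchy_def)

lemma padic_null_zero [simp]: "padic_null p (\<lambda>_. 0)"
  by (simp add: padic_null_def)

lemma padic_null_le:
  assumes "(\<lambda>n. b n) \<longlonglongrightarrow> 0" "\<And>n. padic_abs p (X n) \<le> b n"
  shows "padic_null p X"
  unfolding padic_null_def
  by (rule tendsto_sandwich[OF _ _ tendsto_const assms(1)]) (auto simp: assms(2))

lemma padic_null_add:
  assumes "prime p" "padic_null p X" "padic_null p Y"
  shows "padic_null p (\<lambda>n. X n + Y n)"
  by (rule padic_null_le[OF tendsto_add_zero[OF assms(2,3)[unfolded padic_null_def]]])
     (rule padic_abs_triangle[OF assms(1)])

lemma padic_null_minus: "padic_null p X \<Longrightarrow> padic_null p (\<lambda>n. - X n)"
  by (simp add: padic_null_def)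

lemma padic_null_minus_commute: "padic_null p (\<lambda>n. X n - Y n) \<longleftrightarrow> padic_null p (\<lambda>n. Y n - X n)"
  by (simp add: padic_null_def padic_abs_minus_commute)

lemma padic_cauchy_add:
  assumes "prime p" "padic_cauchy p X" "padic_cauchy p Y"
  shows "padic_cauchy p (\<lambda>n. X n + Y n)"
  unfolding padic_cauchy_def
proof (intro allI impI)
  fix e :: real assume e: "e > 0"
  obtain k where k: "\<forall>m\<ge>k. \<forall>n\<ge>k. padic_abs p (X m - X n) < e"
    using assms(2) e unfolding padic_cauchy_def by blast
  obtain l where l: "\<forall>m\<ge>l. \<forall>n\<ge>l. padic_abs p (Y m - Y n) < e"
    using assms(3) e unfolding padic_cauchy_def by blast
  have "padic_abs p ((X m + Y m) - (X n + Y n)) < e" if "m \<ge> max k l" "n \<ge> max k l" for m n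
    using padic_abs_ultra[OF assms(1), of "X m - X n" "Y m - Y n"]
      k[rule_format, of m n] l[rule_format, of m n] that by (simp add: add_diff_add)
  then show "\<exists>k. \<forall>m\<ge>k. \<forall>n\<ge>k. padic_abs p ((X m + Y m) - (X n + Y n)) < e" by blast
qed

lemma padic_cauchy_minus: "padic_cauchy p X \<Longrightarrow> padic_cauchy p (\<lambda>n. - X n)"
  by (simp add: padic_cauchy_def padic_abs_minus_commute)

lemma padic_cauchy_abs_convergent:
  assumes "prime p" "padic_cauchy p X"
  shows "convergent (\<lambda>n. padic_abs p (X n))"
proof -
  have "Cauchy (\<lambda>n. padic_abs p (X n))"
    unfolding Cauchy_def dist_real_def
    using assms(2) padic_abs_diff_triangle[OF assms(1)] unfolding padic_cauchy_def
    by (meson le_less_trans)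
  then show ?thesis by (simp add: Cauchy_convergent_iff)
qed

lemma padic_cauchy_bounded:
  assumes "prime p" "padic_cauchy p X"
  shows "\<exists>b>0. \<forall>n. padic_abs p (X n) \<le> b"
proof -
  have "Bseq (\<lambda>n. padic_abs p (X n))"
    using padic_cauchy_abs_convergent[OF assms] convergent_imp_Bseq by blast
  then obtain b where "b > 0" "\<And>n. norm (padic_abs p (X n)) \<le> b" by (rule BseqE) blast
  then show ?thesis by (intro exI[of _ b]) simp
qed

lemma padic_null_mult_bounded:
  assumes "prime p" "padic_cauchy p X" "padic_null p Y"
  shows "padic_null p (\<lambda>n. X n * Y n)"
proof -
  obtain b where b: "b > 0" "\<And>n. padic_abs p (X n) \<le> b" using padic_cauchy_bounded[OF assms(1,2)] by blast
  show ?thesis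
  proof (rule padic_null_le)
    show "(\<lambda>n. b * padic_abs p (Y n)) \<longlonglongrightarrow> 0"
      using assms(3) unfolding padic_null_def by (rule tendsto_mult_right_zero)
    show "padic_abs p (X n * Y n) \<le> b * padic_abs p (Y n)" for n
      using b by (simp add: padic_abs_mult[OF assms(1)] mult_right_mono)
  qed
qed

lemma padic_cauchy_mult:
  assumes "prime p" "padic_cauchy p X" "padic_cauchy p Y"
  shows "padic_cauchy p (\<lambda>n. X n * Y n)"
  unfolding padic_cauchy_def
proof (intro allI impI)
  fix e :: real assume e: "e > 0"
  obtain a where a: "a > 0" "\<And>n. padic_abs p (X n) \<le> a" using padic_cauchy_bounded[OF assms(1,2)] by blast
  obtain b where b: "b > 0" "\<And>n. padic_abs p (Y n) \<le> b" using padic_cauchy_bounded[OF assms(1,3)] by blast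
  obtain k where k: "\<forall>m\<ge>k. \<forall>n\<ge>k. padic_abs p (X m - X n) < e / b"
    using assms(2) e b unfolding padic_cauchy_def by (meson divide_pos_pos)
  obtain l where l: "\<forall>m\<ge>l. \<forall>n\<ge>l. padic_abs p (Y m - Y n) < e / a"
    using assms(3) e a unfolding padic_cauchy_def by (meson divide_pos_pos)
  have "padic_abs p (X m * Y m - X n * Y n) < e" if mn: "m \<ge> max k l" "n \<ge> max k l" for m n
  proof -
    have "padic_abs p (X m * (Y m - Y n)) \<le> a * padic_abs p (Y m - Y n)"
      using a by (simp add: padic_abs_mult[OF assms(1)] mult_right_mono)
    also have "\<dots> < e" using l mn a by (simp add: field_simps)
    finally have 1: "padic_abs p (X m * (Y m - Y n)) < e" .
    have "padic_abs p ((X m - X n) * Y n) \<le> padic_abs p (X m - X n) * b"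
      using b by (simp add: padic_abs_mult[OF assms(1)] mult_left_mono)
    also have "\<dots> < e" using k mn b by (simp add: field_simps)
    finally have 2: "padic_abs p ((X m - X n) * Y n) < e" .
    have "X m * Y m - X n * Y n = X m * (Y m - Y n) + (X m - X n) * Y n" by (simp add: algebra_simps)
    with 1 2 padic_abs_ultra[OF assms(1), of "X m * (Y m - Y n)" "(X m - X n) * Y n"]
    show ?thesis by simp
  qed
  then show "\<exists>k. \<forall>m\<ge>k. \<forall>n\<ge>k. padic_abs p (X m * Y m - X n * Y n) < e" by blast
qed

lemma padic_cauchy_not_null:
  assumes "prime p" "padic_cauchy p X" "\<not> padic_null p X"
  shows "\<exists>b>0. \<exists>k. \<forall>n\<ge>k. b < padic_abs p (X n)"
proof -
  obtain L where L: "(\<lambda>n. padic_abs p (X n)) \<longlonglongrightarrow> L"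
    using padic_cauchy_abs_convergent[OF assms(1,2)] convergent_def by blast
  have "L \<ge> 0" by (rule LIMSEQ_le_const[OF L]) auto
  moreover have "L \<noteq> 0" using L assms(3) unfolding padic_null_def by auto
  ultimately have L0: "L > 0" by simp
  then have "eventually (\<lambda>n. L / 2 < padic_abs p (X n)) sequentially"
    by (intro order_tendstoD(1)[OF L]) auto
  then show ?thesis using L0 unfolding eventually_sequentially by (intro exI[of _ "L / 2"]) auto
qed

lemma padic_abs_diff_inverse:
  assumes "prime p" "x \<noteq> 0" "y \<noteq> 0"
  shows "padic_abs p (inverse x - inverse y) = padic_abs p (x - y) * inverse (padic_abs p x) * inverse (padic_abs p y)"
proof -
  have "inverse x - inverse y = (y - x) * inverse x * inverse y"
    using assms by (simp add: field_simps)
  then show ?thesis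
    by (simp only: padic_abs_mult[OF assms(1)] padic_abs_inverse[OF assms(1)] padic_abs_minus_commute[of p y x])
qed

lemma padic_abs_diff_inverse_le:
  assumes "prime p" "a > 0" "b > 0" "a < padic_abs p x" "b < padic_abs p y"
  shows "padic_abs p (inverse x - inverse y) \<le> padic_abs p (x - y) * inverse a * inverse b"
proof -
  have "x \<noteq> 0" "y \<noteq> 0" using assms by auto
  then show ?thesis
    unfolding padic_abs_diff_inverse[OF assms(1) \<open>x \<noteq> 0\<close> \<open>y \<noteq> 0\<close>]
    using assms by (intro mult_mono le_imp_inverse_le) auto
qed

lemma padic_cauchy_inverse:
  assumes "prime p" "padic_cauchy p X" "\<not> padic_null p X"
  shows "padic_cauchy p (\<lambda>n. inverse (X n))"
  unfolding padic_cauchy_def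
proof (intro allI impI)
  fix e :: real assume e: "e > 0"
  obtain b k where b: "b > 0" "\<And>n. n \<ge> k \<Longrightarrow> b < padic_abs p (X n)"
    using padic_cauchy_not_null[OF assms] by blast
  have "e * b * b > 0" using e b by simp
  then obtain l where l: "\<forall>m\<ge>l. \<forall>n\<ge>l. padic_abs p (X m - X n) < e * b * b"
    using assms(2) unfolding padic_cauchy_def by blast
  have "padic_abs p (inverse (X m) - inverse (X n)) < e" if mn: "m \<ge> max k l" "n \<ge> max k l" for m n
  proof -
    have "padic_abs p (inverse (X m) - inverse (X n)) \<le> padic_abs p (X m - X n) * inverse b * inverse b"
      using b mn by (intro padic_abs_diff_inverse_le[OF assms(1)]) auto
    also have "\<dots> < e" using l mn b by (simp add: field_simps)
    finally show ?thesis .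
  qed
  then show "\<exists>k. \<forall>m\<ge>k. \<forall>n\<ge>k. padic_abs p (inverse (X m) - inverse (X n)) < e" by blast
qed

lemma padic_null_diff_inverse:
  assumes "prime p" "padic_cauchy p X" "\<not> padic_null p X" "padic_cauchy p Y" "\<not> padic_null p Y"
    and "padic_null p (\<lambda>n. X n - Y n)"
  shows "padic_null p (\<lambda>n. inverse (X n) - inverse (Y n))"
proof -
  obtain a k where a: "a > 0" "\<And>n. n \<ge> k \<Longrightarrow> a < padic_abs p (X n)"
    using padic_cauchy_not_null[OF assms(1-3)] by blast
  obtain b l where b: "b > 0" "\<And>n. n \<ge> l \<Longrightarrow> b < padic_abs p (Y n)"
    using padic_cauchy_not_null[OF assms(1,4,5)] by blast
  have ev: "eventually (\<lambda>n. padic_abs p (inverse (X n) - inverse (Y n)) \<le> padic_abs p (X n - Y n) * inverse a * inverse b) sequentially"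
    unfolding eventually_sequentially
    using a b by (intro exI[of _ "max k l"] allI impI padic_abs_diff_inverse_le[OF assms(1)]) auto
  have lim: "(\<lambda>n. padic_abs p (X n - Y n) * inverse a * inverse b) \<longlonglongrightarrow> 0"
    using assms(6) unfolding padic_null_def by (intro tendsto_mult_left_zero)
  show ?thesis
    unfolding padic_null_def by (rule Lim_null_comparison[OF _ lim]) (use ev in simp)
qed

text \<open>The prime is passed as the cardinality of a type, so that the fields \<open>\<rat>\<^sub>p\<close> for all
  primes \<open>p\<close> form one type constructor.\<close>

typedef (overloaded) 'p padic_seq = "{X. padic_cauchy CARD('p::prime_card) X}"
  morphisms seq Abs_padic_seq
  by (rule exI[of _ "\<lambda>_. 0"]) simp

definition padic_equiv :: "'p::prime_card padic_seq \<Rightarrow> 'p padic_seq \<Rightarrow> bool" where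
  "padic_equiv X Y \<longleftrightarrow> padic_null CARD('p) (\<lambda>n. seq X n - seq Y n)"

lemma seq_cauchy [simp]: "padic_cauchy CARD('p) (seq (X :: 'p::prime_card padic_seq))"
  using seq[of X] by simp

lemma seq_Abs [simp]: "padic_cauchy CARD('p) X \<Longrightarrow> seq (Abs_padic_seq X :: 'p::prime_card padic_seq) = X"
  by (simp add: Abs_padic_seq_inverse)

lemma equivp_padic_equiv: "equivp (padic_equiv :: 'p::prime_card padic_seq \<Rightarrow> 'p padic_seq \<Rightarrow> bool)"
proof (rule equivpI)
  show "reflp (padic_equiv :: 'p padic_seq \<Rightarrow> 'p padic_seq \<Rightarrow> bool)"
    by (rule reflpI) (simp add: padic_equiv_def)
  show "symp (padic_equiv :: 'p padic_seq \<Rightarrow> 'p padic_seq \<Rightarrow> bool)"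
    by (rule sympI) (unfold padic_equiv_def, rule padic_null_minus_commute[THEN iffD1])
  show "transp (padic_equiv :: 'p padic_seq \<Rightarrow> 'p padic_seq \<Rightarrow> bool)"
    by (rule transpI) (auto simp: padic_equiv_def dest: padic_null_add[OF prime_card])
qed

quotient_type (overloaded) 'p padic = "'p::prime_card padic_seq" / padic_equiv
  by (rule equivp_padic_equiv)

lemma padic_null_cong:
  assumes "prime p" "padic_null p (\<lambda>n. X n - Y n)"
  shows "padic_null p X \<longleftrightarrow> padic_null p Y"
proof
  assume "padic_null p X"
  from padic_null_add[OF assms(1) this padic_null_minus[OF assms(2)]] show "padic_null p Y" by simp
next
  assume "padic_null p Y"
  from padic_null_add[OF assms(1) assms(2) this] show "padic_null p X" by simp
qed

lemma padic_exhaust: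
  obtains X where "x = abs_padic X"
proof -
  have "\<exists>X. x = abs_padic X"
    by (rule padic.abs_induct[of "\<lambda>x. \<exists>X. x = abs_padic X"]) (rule exI, rule refl)
  then show ?thesis using that by blast
qed

instantiation padic :: (prime_card) field
begin

lift_definition zero_padic :: "'a padic" is "Abs_padic_seq (\<lambda>_. 0)" .

lift_definition one_padic :: "'a padic" is "Abs_padic_seq (\<lambda>_. 1)" .

lift_definition plus_padic :: "'a padic \<Rightarrow> 'a padic \<Rightarrow> 'a padic"
  is "\<lambda>X Y. Abs_padic_seq (\<lambda>n. seq X n + seq Y n)"
  using padic_null_add[OF prime_card]
  by (fastforce simp: padic_equiv_def padic_cauchy_add[OF prime_card] add_diff_add)

lift_definition uminus_padic :: "'a padic \<Rightarrow> 'a padic"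
  is "\<lambda>X. Abs_padic_seq (\<lambda>n. - seq X n)"
  by (drule padic_equiv_def[THEN iffD1, THEN padic_null_minus])
     (simp add: padic_equiv_def padic_cauchy_minus minus_diff_minus)

definition minus_padic :: "'a padic \<Rightarrow> 'a padic \<Rightarrow> 'a padic" where
  "minus_padic x y = x + - y"

lift_definition times_padic :: "'a padic \<Rightarrow> 'a padic \<Rightarrow> 'a padic"
  is "\<lambda>X Y. Abs_padic_seq (\<lambda>n. seq X n * seq Y n)"
proof -
  fix X X' Y Y' :: "'a padic_seq"
  assume XX: "padic_equiv X X'" and YY: "padic_equiv Y Y'"
  have "padic_null CARD('a) (\<lambda>n. seq X n * (seq Y n - seq Y' n) + seq Y' n * (seq X n - seq X' n))"
    using padic_null_add[OF prime_card
        padic_null_mult_bounded[OF prime_card seq_cauchy YY[unfolded padic_equiv_def]]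
        padic_null_mult_bounded[OF prime_card seq_cauchy XX[unfolded padic_equiv_def]]] .
  also have "(\<lambda>n. seq X n * (seq Y n - seq Y' n) + seq Y' n * (seq X n - seq X' n)) =
      (\<lambda>n. seq X n * seq Y n - seq X' n * seq Y' n)"
    by (simp add: fun_eq_iff algebra_simps)
  finally show "padic_equiv (Abs_padic_seq (\<lambda>n. seq X n * seq Y n) :: 'a padic_seq)
      (Abs_padic_seq (\<lambda>n. seq X' n * seq Y' n))"
    by (simp add: padic_equiv_def padic_cauchy_mult[OF prime_card])
qed

lift_definition inverse_padic :: "'a padic \<Rightarrow> 'a padic"
  is "\<lambda>X. if padic_null CARD('a) (seq X) then Abs_padic_seq (\<lambda>_. 0)
          else Abs_padic_seq (\<lambda>n. inverse (seq X n))"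
proof -
  fix X Y :: "'a padic_seq"
  let ?inv = "\<lambda>X. if padic_null CARD('a) (seq X) then Abs_padic_seq (\<lambda>_. 0)
    else Abs_padic_seq (\<lambda>n. inverse (seq X n)) :: 'a padic_seq"
  assume "padic_equiv X Y"
  then have XY: "padic_null CARD('a) (\<lambda>n. seq X n - seq Y n)" by (simp add: padic_equiv_def)
  show "padic_equiv (?inv X) (?inv Y)"
  proof (cases "padic_null CARD('a) (seq X)")
    case True
    then show ?thesis
      using padic_null_cong[OF prime_card XY] by (simp add: padic_equiv_def)
  next
    case False
    then have Y: "\<not> padic_null CARD('a) (seq Y)" using padic_null_cong[OF prime_card XY] by simp
    show ?thesis
      using padic_null_diff_inverse[OF prime_card seq_cauchy False seq_cauchy Y XY] False Y
      by (simp add: padic_equiv_def padic_cauchy_inverse[OF prime_card])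
  qed
qed

definition divide_padic :: "'a padic \<Rightarrow> 'a padic \<Rightarrow> 'a padic" where
  "divide_padic x y = x * inverse y"

instance
proof
  fix a b c :: "'a padic"
  note simps = padic_equiv_def padic_cauchy_add[OF prime_card] padic_cauchy_minus
    padic_cauchy_mult[OF prime_card] padic_cauchy_inverse[OF prime_card]
  show "a + b + c = a + (b + c)"
    by transfer (simp add: simps algebra_simps)
  show "a + b = b + a"
    by transfer (simp add: simps algebra_simps)
  show "0 + a = a"
    by transfer (simp add: simps)
  show "- a + a = 0"
    by transfer (simp add: simps)
  show "a - b = a + - b"
    by (rule minus_padic_def)
  show "a * b * c = a * (b * c)"
    by transfer (simp add: simps algebra_simps)
  show "a * b = b * a"
    by transfer (simp add: simps algebra_simps)
  show "1 * a = a"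
    by transfer (simp add: simps)
  show "(a + b) * c = a * c + b * c"
    by transfer (simp add: simps algebra_simps)
  show "(0 :: 'a padic) \<noteq> 1"
    by transfer (simp add: simps padic_null_def prime_card LIMSEQ_const_iff)
  show "inverse a * a = 1" if "a \<noteq> 0"
  proof -
    obtain X where X: "a = abs_padic X" by (rule padic_exhaust)
    have nz: "\<not> padic_null CARD('a) (seq X)"
      using that by (simp add: X zero_padic_def padic.abs_eq_iff simps)
    obtain b k where bk: "b > 0" "\<And>n. n \<ge> k \<Longrightarrow> b < padic_abs CARD('a) (seq X n)"
      using padic_cauchy_not_null[OF prime_card seq_cauchy nz] by blast
    have "eventually (\<lambda>n. padic_abs CARD('a) (inverse (seq X n) * seq X n - 1) = 0) sequentially"
      unfolding eventually_sequentially
    proof (intro exI[of _ k] allI impI)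
      fix n assume "k \<le> n"
      then have "seq X n \<noteq> 0" using bk(2)[of n] bk(1) by auto
      then show "padic_abs CARD('a) (inverse (seq X n) * seq X n - 1) = 0" by simp
    qed
    then have "padic_null CARD('a) (\<lambda>n. inverse (seq X n) * seq X n - 1)"
      unfolding padic_null_def by (rule tendsto_eventually)
    then show ?thesis
      using nz by (simp add: X one_padic_def inverse_padic.abs_eq times_padic.abs_eq padic.abs_eq_iff simps)
  qed
  show "a div b = a * inverse b"
    by (rule divide_padic_def)
  show "inverse (0 :: 'a padic) = 0"
    by transfer (simp add: simps)
qed

end

lemma of_nat_padic: "of_nat m = abs_padic (Abs_padic_seq (\<lambda>_. of_nat m) :: 'p::prime_card padic_seq)"
proof (induction m)
  case 0
  show ?case by (simp add: zero_padic_def)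
next
  case (Suc m)
  then show ?case by (simp add: one_padic_def plus_padic.abs_eq)
qed

instance padic :: (prime_card) field_char_0
proof
  show "inj (of_nat :: nat \<Rightarrow> 'a padic)"
  proof (rule injI)
    fix m n assume "(of_nat m :: 'a padic) = of_nat n"
    then have "padic_null CARD('a) (\<lambda>_. of_nat m - of_nat n)"
      by (simp add: of_nat_padic padic.abs_eq_iff padic_equiv_def)
    then have "padic_abs CARD('a) (of_nat m - of_nat n) = 0"
      by (simp add: padic_null_def LIMSEQ_const_iff)
    then show "m = n" by (simp add: prime_card)
  qed
qed

lemma of_rat_padic: "of_rat x = abs_padic (Abs_padic_seq (\<lambda>_. x) :: 'p::prime_card padic_seq)"
proof -
  have int: "of_int a = abs_padic (Abs_padic_seq (\<lambda>_. of_int a) :: 'p padic_seq)" for a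
    by (cases a rule: int_diff_cases)
       (simp add: of_nat_padic minus_padic_def plus_padic.abs_eq uminus_padic.abs_eq)
  obtain a b where x: "x = of_int a / of_int b" "b \<noteq> 0" by (rule rat_of_int_divide_cases)
  have "abs_padic (Abs_padic_seq (\<lambda>_. x) :: 'p padic_seq) * of_int b = of_int a"
    using x by (simp add: int times_padic.abs_eq)
  then have "abs_padic (Abs_padic_seq (\<lambda>_. x) :: 'p padic_seq) = of_int a / of_int b"
    using x(2) by (simp add: eq_divide_eq)
  then show ?thesis by (simp add: x(1) of_rat_divide)
qed


section \<open>The \<open>p\<close>-adic absolute value and topology\<close>

lift_definition padic_norm :: "'a::prime_card padic \<Rightarrow> real"
  is "\<lambda>X. lim (\<lambda>n. padic_abs CARD('a) (seq X n))"
proof -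
  fix X Y :: "'a padic_seq" assume XY: "padic_equiv X Y"
  let ?f = "\<lambda>X n. padic_abs CARD('a) (seq X n)"
  have lim: "?f X \<longlonglongrightarrow> lim (?f X)" for X :: "'a padic_seq"
    using padic_cauchy_abs_convergent[OF prime_card seq_cauchy] by (simp add: convergent_LIMSEQ_iff)
  have "(\<lambda>n. ?f X n - ?f Y n) \<longlonglongrightarrow> 0"
  proof (rule Lim_null_comparison)
    show "(\<lambda>n. padic_abs CARD('a) (seq X n - seq Y n)) \<longlonglongrightarrow> 0"
      using XY by (simp add: padic_equiv_def padic_null_def)
  qed (simp add: padic_abs_diff_triangle[OF prime_card])
  moreover have "(\<lambda>n. ?f X n - ?f Y n) \<longlonglongrightarrow> lim (?f X) - lim (?f Y)"
    by (intro tendsto_diff lim)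
  ultimately show "lim (?f X) = lim (?f Y)" using LIMSEQ_unique by fastforce
qed

lemma padic_norm_LIMSEQ:
  "(\<lambda>n. padic_abs CARD('p) (seq X n)) \<longlonglongrightarrow> padic_norm (abs_padic X :: 'p::prime_card padic)"
  using padic_cauchy_abs_convergent[OF prime_card seq_cauchy, of X]
  by (simp add: padic_norm.abs_eq convergent_LIMSEQ_iff)

lemma padic_norm_of_rat [simp]: "padic_norm (of_rat x :: 'p::prime_card padic) = padic_abs CARD('p) x"
  using padic_norm_LIMSEQ[of "Abs_padic_seq (\<lambda>_. x) :: 'p padic_seq"]
  by (simp add: of_rat_padic LIMSEQ_const_iff)

lemma padic_norm_0 [simp]: "padic_norm (0 :: 'p::prime_card padic) = 0"
  using padic_norm_of_rat[of 0, where ?'p = 'p] by simp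

lemma padic_norm_ge_0 [simp]: "padic_norm (x :: 'p::prime_card padic) \<ge> 0"
  by (rule padic_exhaust[of x]) (auto intro: LIMSEQ_le_const[OF padic_norm_LIMSEQ])

lemma padic_norm_eq_0 [simp]: "padic_norm (x :: 'p::prime_card padic) = 0 \<longleftrightarrow> x = 0"
proof
  assume 0: "padic_norm x = 0"
  obtain X where X: "x = abs_padic X" by (rule padic_exhaust)
  from padic_norm_LIMSEQ[of X] 0 X have "padic_null CARD('p) (seq X)" by (simp add: padic_null_def)
  then show "x = 0" by (simp add: X zero_padic_def padic.abs_eq_iff padic_equiv_def)
qed simp

lemma padic_norm_mult: "padic_norm (x * y) = padic_norm x * padic_norm (y :: 'p::prime_card padic)"
proof -
  obtain X where X: "x = abs_padic X" by (rule padic_exhaust)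
  obtain Y where Y: "y = abs_padic Y" by (rule padic_exhaust)
  have "(\<lambda>n. padic_abs CARD('p) (seq X n) * padic_abs CARD('p) (seq Y n)) \<longlonglongrightarrow> padic_norm (x * y)"
    using padic_norm_LIMSEQ[of "Abs_padic_seq (\<lambda>n. seq X n * seq Y n) :: 'p padic_seq"]
    by (simp add: X Y times_padic.abs_eq padic_cauchy_mult[OF prime_card] padic_abs_mult[OF prime_card])
  moreover have "(\<lambda>n. padic_abs CARD('p) (seq X n) * padic_abs CARD('p) (seq Y n)) \<longlonglongrightarrow> padic_norm x * padic_norm y"
    unfolding X Y by (intro tendsto_mult padic_norm_LIMSEQ)
  ultimately show ?thesis using LIMSEQ_unique by blast
qed

lemma padic_norm_ultra: "padic_norm (x + y) \<le> max (padic_norm x) (padic_norm (y :: 'p::prime_card padic))"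
proof -
  obtain X where X: "x = abs_padic X" by (rule padic_exhaust)
  obtain Y where Y: "y = abs_padic Y" by (rule padic_exhaust)
  have "(\<lambda>n. padic_abs CARD('p) (seq X n + seq Y n)) \<longlonglongrightarrow> padic_norm (x + y)"
    using padic_norm_LIMSEQ[of "Abs_padic_seq (\<lambda>n. seq X n + seq Y n) :: 'p padic_seq"]
    by (simp add: X Y plus_padic.abs_eq padic_cauchy_add[OF prime_card])
  moreover have "(\<lambda>n. max (padic_abs CARD('p) (seq X n)) (padic_abs CARD('p) (seq Y n)))
      \<longlonglongrightarrow> max (padic_norm x) (padic_norm y)"
    unfolding X Y by (intro tendsto_max padic_norm_LIMSEQ)
  ultimately show ?thesis by (rule LIMSEQ_le) (auto intro: padic_abs_ultra[OF prime_card])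
qed

lemma padic_norm_minus [simp]: "padic_norm (- x) = padic_norm (x :: 'p::prime_card padic)"
proof -
  have "padic_norm (- 1 :: 'p padic) = 1"
    using padic_norm_of_rat[of "- 1", where ?'p = 'p] by (simp add: of_rat_minus prime_card)
  then show ?thesis using padic_norm_mult[of "- 1" x] by simp
qed

instantiation padic :: (prime_card) metric_space
begin

definition dist_padic :: "'a padic \<Rightarrow> 'a padic \<Rightarrow> real" where
  "dist_padic x y = padic_norm (x - y)"

definition uniformity_padic :: "('a padic \<times> 'a padic) filter" where
  "uniformity_padic = (INF e\<in>{0 <..}. principal {(x, y). dist x y < e})"

definition open_padic :: "'a padic set \<Rightarrow> bool" where
  "open_padic U \<longleftrightarrow> (\<forall>x\<in>U. eventually (\<lambda>(x', y). x' = x \<longrightarrow> y \<in> U) uniformity)"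

instance
proof
  fix x y z :: "'a padic" and U :: "'a padic set"
  show "(uniformity :: ('a padic \<times> 'a padic) filter) = (INF e\<in>{0 <..}. principal {(x, y). dist x y < e})"
    by (rule uniformity_padic_def)
  show "open U \<longleftrightarrow> (\<forall>x\<in>U. eventually (\<lambda>(x', y). x' = x \<longrightarrow> y \<in> U) uniformity)"
    by (rule open_padic_def)
  show "dist x y = 0 \<longleftrightarrow> x = y" by (simp add: dist_padic_def)
  have "padic_norm (x - y) \<le> max (padic_norm (x - z)) (padic_norm (z - y))"
    using padic_norm_ultra[of "x - z" "z - y"] by simp
  moreover have "padic_norm (z - y) = padic_norm (y - z)" using padic_norm_minus[of "y - z"] by simp
  ultimately show "dist x y \<le> dist x z + dist y z"
    using padic_norm_ge_0[of "x - z"] padic_norm_ge_0[of "y - z"] unfolding dist_padic_def by linarith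
qed

end

lemma padic_dist_of_rat: "dist (of_rat x) (of_rat y :: 'p::prime_card padic) = padic_abs CARD('p) (x - y)"
  by (simp add: dist_padic_def flip: of_rat_diff)

lemma padic_LIMSEQ_of_rat: "(\<lambda>n. of_rat (seq X n)) \<longlonglongrightarrow> (abs_padic X :: 'p::prime_card padic)"
proof (rule metric_LIMSEQ_I)
  fix e :: real assume e: "e > 0"
  then obtain k where k: "\<forall>m\<ge>k. \<forall>n\<ge>k. padic_abs CARD('p) (seq X m - seq X n) < e / 2"
    using seq_cauchy[of X] unfolding padic_cauchy_def by (meson half_gt_zero)
  have "dist (of_rat (seq X n)) (abs_padic X :: 'p padic) < e" if n: "n \<ge> k" for n
  proof -
    have c: "padic_cauchy CARD('p) (\<lambda>m. seq X n + - seq X m)"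
      by (intro padic_cauchy_add padic_cauchy_minus prime_card padic_cauchy_const seq_cauchy)
    have "(\<lambda>m. padic_abs CARD('p) (seq X n - seq X m)) \<longlonglongrightarrow> dist (of_rat (seq X n)) (abs_padic X :: 'p padic)"
      using padic_norm_LIMSEQ[of "Abs_padic_seq (\<lambda>m. seq X n + - seq X m) :: 'p padic_seq"] c
      by (simp add: dist_padic_def of_rat_padic minus_padic_def plus_padic.abs_eq uminus_padic.abs_eq padic_cauchy_minus)
    then have "dist (of_rat (seq X n)) (abs_padic X :: 'p padic) \<le> e / 2"
      by (rule LIMSEQ_le_const2) (use k n in \<open>auto intro: less_imp_le\<close>)
    with e show ?thesis by simp
  qed
  then show "\<exists>k. \<forall>n\<ge>k. dist (of_rat (seq X n)) (abs_padic X :: 'p padic) < e" by blast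
qed

lemma padic_rat_dense: "closure (range of_rat) = (UNIV :: 'p::prime_card padic set)"
proof -
  have "x \<in> closure (range of_rat)" for x :: "'p padic"
  proof -
    obtain X where X: "x = abs_padic X" by (rule padic_exhaust)
    have "(\<forall>n. of_rat (seq X n) \<in> range (of_rat :: rat \<Rightarrow> 'p padic)) \<and> (\<lambda>n. of_rat (seq X n)) \<longlonglongrightarrow> x"
      unfolding X using padic_LIMSEQ_of_rat by blast
    then show ?thesis unfolding closure_sequential
      by (intro exI[of _ "\<lambda>n. of_rat (seq X n)"])
  qed
  then show ?thesis by blast
qed

instance padic :: (prime_card) complete_space
proof
  fix x :: "nat \<Rightarrow> 'a padic" assume C: "Cauchy x"
  have "\<exists>r. dist (of_rat r) (x n) < 1 / real (Suc n)" for n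
  proof -
    have "x n \<in> closure (range of_rat)" by (simp add: padic_rat_dense)
    moreover have "1 / real (Suc n) > 0" by simp
    ultimately show ?thesis unfolding closure_approachable by blast
  qed
  then obtain r where r: "\<And>n. dist (of_rat (r n)) (x n) < 1 / real (Suc n)" by metis
  have r0: "(\<lambda>n. dist (of_rat (r n)) (x n)) \<longlonglongrightarrow> 0"
  proof (rule Lim_null_comparison[OF _ LIMSEQ_inverse_real_of_nat])
    show "eventually (\<lambda>n. norm (dist (of_rat (r n)) (x n)) \<le> inverse (real (Suc n))) sequentially"
      by (rule always_eventually) (use r in \<open>simp add: inverse_eq_divide less_imp_le del: of_nat_Suc\<close>)
  qed
  have "padic_cauchy CARD('a) r"
    unfolding padic_cauchy_def
  proof (intro allI impI)
    fix e :: real assume e: "e > 0"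
    then have e3: "e / 3 > 0" by simp
    obtain k where k: "\<forall>m\<ge>k. \<forall>n\<ge>k. dist (x m) (x n) < e / 3"
      using C e3 unfolding Cauchy_def by blast
    obtain l where l: "\<And>n. n \<ge> l \<Longrightarrow> dist (of_rat (r n)) (x n) < e / 3"
      using order_tendstoD(2)[OF r0 e3] unfolding eventually_sequentially by blast
    have "padic_abs CARD('a) (r m - r n) < e" if "m \<ge> max k l" "n \<ge> max k l" for m n
    proof -
      have "dist (of_rat (r m)) (of_rat (r n) :: 'a padic)
          \<le> dist (of_rat (r m)) (x m) + dist (x m) (x n) + dist (of_rat (r n)) (x n)"
        using dist_triangle[of "of_rat (r m)" "of_rat (r n) :: 'a padic" "x m"]
          dist_triangle[of "x m" "of_rat (r n)" "x n"] dist_commute[of "x n" "of_rat (r n)"] by linarith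
      also have "\<dots> < e" using k[rule_format, of m n] l[of m] l[of n] that by simp
      finally show ?thesis by (simp add: padic_dist_of_rat)
    qed
    then show "\<exists>k. \<forall>m\<ge>k. \<forall>n\<ge>k. padic_abs CARD('a) (r m - r n) < e" by blast
  qed
  then have "(\<lambda>n. of_rat (r n)) \<longlonglongrightarrow> (abs_padic (Abs_padic_seq r) :: 'a padic)" (is "_ \<longlonglongrightarrow> ?L")
    using padic_LIMSEQ_of_rat[of "Abs_padic_seq r :: 'a padic_seq"] by simp
  then have "(\<lambda>n. dist (of_rat (r n)) (x n) + dist (of_rat (r n)) ?L) \<longlonglongrightarrow> 0"
    using r0 by (intro tendsto_add_zero) (simp_all add: tendsto_dist_iff[symmetric])
  then have "(\<lambda>n. dist (x n) ?L) \<longlonglongrightarrow> 0"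
    by (rule Lim_null_comparison[rotated])
       (intro always_eventually allI, simp add: dist_triangle3)
  then have "x \<longlonglongrightarrow> ?L"
    by (simp add: tendsto_dist_iff[symmetric])
  then show "convergent x" by (auto simp: convergent_def)
qed


section \<open>Haar measure and fractional Cesaro-Morrey spaces\<close>

definition padic_haar :: "'p::prime_card padic measure \<Rightarrow> bool" where
  "padic_haar M \<longleftrightarrow> sets M = sets borel \<and>
     (\<forall>a. \<forall>E\<in>sets M. emeasure M ((\<lambda>x. a + x) ` E) = emeasure M E) \<and>
     emeasure M {x. padic_norm x \<le> 1} = 1"

definition padic_ball :: "'p::prime_card padic \<Rightarrow> int \<Rightarrow> 'p padic set" where
  "padic_ball a l = {x. padic_norm (x - a) \<le> real CARD('p) powi l}"

definition locally_integrable :: "'p::prime_card padic measure \<Rightarrow> ('p padic \<Rightarrow> complex) \<Rightarrow> bool" where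
  "locally_integrable M f \<longleftrightarrow> f \<in> borel_measurable M \<and> (\<forall>K. compact K \<longrightarrow> set_integrable M K f)"

text \<open>Only used for positive exponents, where \<open>\<infinity>\<close> is mapped to \<open>\<infinity>\<close>.\<close>

definition ennreal_powr :: "ennreal \<Rightarrow> real \<Rightarrow> ennreal" where
  "ennreal_powr x a = (if x = \<infinity> then \<infinity> else ennreal (enn2real x powr a))"

definition cesaro_morrey_norm ::
  "'p::prime_card padic measure \<Rightarrow> real \<Rightarrow> real \<Rightarrow> real \<Rightarrow> ('p padic \<Rightarrow> complex) \<Rightarrow> ennreal" where
  "cesaro_morrey_norm M \<beta> r q f = (SUP a. SUP l.
     ennreal (measure M (padic_ball a l) powr (1 / q - 1 / r)) *
     ennreal_powr
       (\<integral>\<^sup>+x\<in>padic_ball a l.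
          ennreal_powr
            (ennreal (1 / padic_norm x powr (1 - \<beta>)) *
             (\<integral>\<^sup>+t\<in>{t. padic_norm t \<le> padic_norm x}. ennreal (norm (f t)) \<partial>M)) r \<partial>M)
       (1 / r))"

definition cesaro_morrey_space ::
  "'p::prime_card padic measure \<Rightarrow> real \<Rightarrow> real \<Rightarrow> real \<Rightarrow> ('p padic \<Rightarrow> complex) set" where
  "cesaro_morrey_space M \<beta> r q = {f. locally_integrable M f \<and> cesaro_morrey_norm M \<beta> r q f < \<infinity>}"

definition bounded_on_cesaro_morrey ::
  "'p::prime_card padic measure \<Rightarrow> real \<Rightarrow> real \<Rightarrow> real \<Rightarrow>
   (('p padic \<Rightarrow> complex) \<Rightarrow> 'p padic \<Rightarrow> complex) \<Rightarrow> bool" where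
  "bounded_on_cesaro_morrey M \<beta> r q T \<longleftrightarrow> (\<exists>C>0. \<forall>f\<in>cesaro_morrey_space M \<beta> r q.
     T f \<in> cesaro_morrey_space M \<beta> r q \<and>
     cesaro_morrey_norm M \<beta> r q (T f) \<le> ennreal C * cesaro_morrey_norm M \<beta> r q f)"


section \<open>Hadamard-type fractional integrals\<close>

definition inner_region :: "'p::prime_card padic \<Rightarrow> 'p padic set" where
  "inner_region s = {t. t \<noteq> 0 \<and> padic_norm t < padic_norm s}"

definition outer_region :: "'p::prime_card padic \<Rightarrow> 'p padic set" where
  "outer_region s = {t. t \<noteq> 0 \<and> padic_norm t > padic_norm s}"

definition J_inner_kernel :: "real \<Rightarrow> real \<Rightarrow> 'p::prime_card padic \<Rightarrow> 'p padic \<Rightarrow> real" where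
  "J_inner_kernel \<alpha> \<mu> s t =
     (padic_norm t / padic_norm s) powr \<mu> * ln (padic_norm s / padic_norm t) powr (\<alpha> - 1) * (1 / padic_norm t)"

definition J_outer_kernel :: "real \<Rightarrow> real \<Rightarrow> 'p::prime_card padic \<Rightarrow> 'p padic \<Rightarrow> real" where
  "J_outer_kernel \<alpha> \<mu> s t =
     (padic_norm s / padic_norm t) powr \<mu> * ln (padic_norm t / padic_norm s) powr (\<alpha> - 1) * (1 / padic_norm t)"

definition I_inner_kernel :: "real \<Rightarrow> real \<Rightarrow> 'p::prime_card padic \<Rightarrow> 'p padic \<Rightarrow> real" where
  "I_inner_kernel \<alpha> \<mu> s t =
     (padic_norm t / padic_norm s) powr \<mu> * ln (padic_norm s / padic_norm t) powr (\<alpha> - 1) * (1 / padic_norm s)"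

definition I_outer_kernel :: "real \<Rightarrow> real \<Rightarrow> 'p::prime_card padic \<Rightarrow> 'p padic \<Rightarrow> real" where
  "I_outer_kernel \<alpha> \<mu> s t =
     (padic_norm s / padic_norm t) powr \<mu> * ln (padic_norm t / padic_norm s) powr (\<alpha> - 1) * (1 / padic_norm s)"

text \<open>The operators are meant for \<open>s \<noteq> 0\<close>; at the null point \<open>s = 0\<close> the conventions
  \<open>x / 0 = 0\<close> and \<open>0 powr a = 0\<close> make all four values \<open>0\<close>.\<close>

definition hadamard_J_inner ::
  "'p::prime_card padic measure \<Rightarrow> real \<Rightarrow> real \<Rightarrow> ('p padic \<Rightarrow> complex) \<Rightarrow> 'p padic \<Rightarrow> complex" where
  "hadamard_J_inner M \<alpha> \<mu> f s =
     (1 / Gamma \<alpha>) *\<^sub>R (LINT t:inner_region s|M. J_inner_kernel \<alpha> \<mu> s t *\<^sub>R f t)"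

definition hadamard_J_outer ::
  "'p::prime_card padic measure \<Rightarrow> real \<Rightarrow> real \<Rightarrow> ('p padic \<Rightarrow> complex) \<Rightarrow> 'p padic \<Rightarrow> complex" where
  "hadamard_J_outer M \<alpha> \<mu> f s =
     (1 / Gamma \<alpha>) *\<^sub>R (LINT t:outer_region s|M. J_outer_kernel \<alpha> \<mu> s t *\<^sub>R f t)"

definition hadamard_I_inner ::
  "'p::prime_card padic measure \<Rightarrow> real \<Rightarrow> real \<Rightarrow> ('p padic \<Rightarrow> complex) \<Rightarrow> 'p padic \<Rightarrow> complex" where
  "hadamard_I_inner M \<alpha> \<mu> f s =
     (1 / Gamma \<alpha>) *\<^sub>R (LINT t:inner_region s|M. I_inner_kernel \<alpha> \<mu> s t *\<^sub>R f t)"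

definition hadamard_I_outer ::
  "'p::prime_card padic measure \<Rightarrow> real \<Rightarrow> real \<Rightarrow> ('p padic \<Rightarrow> complex) \<Rightarrow> 'p padic \<Rightarrow> complex" where
  "hadamard_I_outer M \<alpha> \<mu> f s =
     (1 / Gamma \<alpha>) *\<^sub>R (LINT t:outer_region s|M. I_outer_kernel \<alpha> \<mu> s t *\<^sub>R f t)"

text \<open>A Bochner integral that does not converge has the value \<open>0\<close>, so boundedness alone does not
  say that the operator is defined on the space. The following predicate does.\<close>

definition converges_on_cesaro_morrey ::
  "'p::prime_card padic measure \<Rightarrow> real \<Rightarrow> real \<Rightarrow> real \<Rightarrow>
   ('p padic \<Rightarrow> 'p padic set) \<Rightarrow> ('p padic \<Rightarrow> 'p padic \<Rightarrow> real) \<Rightarrow> bool" where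
  "converges_on_cesaro_morrey M \<beta> r q D k \<longleftrightarrow>
     (\<forall>f\<in>cesaro_morrey_space M \<beta> r q. \<forall>s. s \<noteq> 0 \<longrightarrow> set_integrable M (D s) (\<lambda>t. k s t *\<^sub>R f t))"

end

theory Submission
  imports Defs "HOL-Real_Asymp.Real_Asymp"
begin

text \<open>All four kernels depend only on the absolute values of \<open>s\<close> and \<open>t\<close>: with \<open>|s| = p\<^sup>j\<close> and
  \<open>|t| = p\<^sup>j\<^sup>+\<^sup>n\<close> they have the form \<open>w n / |t|\<close> for a nonnegative function \<open>w\<close> on the integers.
  The Cesaro-Morrey norm, too, sees \<open>f\<close> only through the integrals of \<open>|f|\<close> over the balls centred
  at \<open>0\<close>, so the question is about sequences indexed by the integers.

  On these sequences such an operator is dominated by a convolution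
  (\<open>ball_integral_radial_operator_le\<close>): the Cesaro mean of \<open>T f\<close> is at most a superposition, with
  weights \<open>w n p\<^sup>-\<^sup>n\<^sup>\<beta>\<close>, of the Cesaro means of \<open>f\<close> dilated by \<open>p\<^sup>n\<close>. Such a dilation multiplies
  the Morrey norm by \<open>p\<^sup>-\<^sup>n\<^sup>/\<^sup>q\<close>, because it maps balls to balls and spheres to spheres
  (\<open>shell_mass_scale\<close>). Convexity of the power \<open>r\<close>
  (\<open>nn_integral_weighted_power_mean\<close>) therefore bounds the operator by the sum over all \<open>n\<close> of
  \<open>w n p\<^sup>-\<^sup>n\<^sup>(\<^sup>\<beta>\<^sup>+\<^sup>1\<^sup>/\<^sup>q\<^sup>)\<close> (\<open>cesaro_morrey_norm_radial_operator_le\<close>), and the same sum controls the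
  absolute convergence of the defining integral (\<open>integrable_radial_kernel\<close>).

  For the Hadamard kernels this sum is a series of powers of \<open>i\<close> times a geometric progression, and
  it converges when the ratio of the progression is less than one, which is the hypothesis
  on \<open>\<mu>\<close>. The two families of operators differ by a shift of \<open>\<mu>\<close>.

  The Haar measure enters only through the measure of balls, which follows from the partition of a
  ball into \<open>p\<close> translates of the next smaller ball (\<open>padic_ball_split\<close>).\<close>

section \<open>The value group and the residue field of the \<open>p\<close>-adic field\<close>

lemma CARD_gt_1: "1 < real CARD('p::prime_card)"
  using prime_gt_1_nat[OF prime_card[where 'a='p]] by simp

lemma padic_norm_le_0_iff [simp]: "padic_norm (x :: 'p::prime_card padic) \<le> 0 \<longleftrightarrow> x = 0"
  using padic_norm_ge_0[of x] by (simp add: order.eq_iff flip: padic_norm_eq_0)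

lemma padic_norm_pos_iff [simp]: "0 < padic_norm (x :: 'p::prime_card padic) \<longleftrightarrow> x \<noteq> 0"
  by (simp add: less_le)

lemma padic_norm_eq_of_close:
  assumes "padic_norm (x - y :: 'p::prime_card padic) < padic_norm x"
  shows "padic_norm y = padic_norm x"
  using assms padic_norm_ultra[of "x - y" y] padic_norm_ultra[of "y - x" x]
    padic_norm_minus[of "x - y"] by auto

text \<open>Every nonzero \<open>x\<close> has a rational \<open>r\<close> with \<open>|x - r| < |x|\<close>; by the
  ultrametric inequality \<open>|x| = |r|\<close>, and on the rationals the value is a power of \<open>p\<close> by definition.\<close>

lemma padic_norm_range:
  assumes "x \<noteq> 0"
  shows "\<exists>k::int. padic_norm (x :: 'p::prime_card padic) = real CARD('p) powr k"
proof -
  have "x \<in> closure (range of_rat)" by (simp add: padic_rat_dense)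
  moreover have "padic_norm x > 0" using assms by (simp add: less_le)
  ultimately obtain r where "dist (of_rat r) x < padic_norm x"
    unfolding closure_approachable by blast
  then have "padic_norm (x - of_rat r) < padic_norm x" by (simp add: dist_commute flip: dist_padic_def)
  then have "padic_norm x = padic_abs CARD('p) r"
    using padic_norm_eq_of_close[of x "of_rat r"] by simp
  moreover have "r \<noteq> 0" using calculation assms by auto
  ultimately show ?thesis using CARD_gt_1[where 'p='p]
    by (auto simp: padic_abs_def powr_real_of_int')
qed

text \<open>The exponent \<open>k\<close> of \<open>|x| = p\<^sup>k\<close>, that is, minus the usual valuation; meaningful only
  for \<open>x \<noteq> 0\<close>.\<close>

definition padic_log :: "'p::prime_card padic \<Rightarrow> int" where
  "padic_log x = \<lfloor>log (real CARD('p)) (padic_norm x)\<rfloor>"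

lemma padic_norm_eq_powr_log:
  "x \<noteq> 0 \<Longrightarrow> padic_norm (x :: 'p::prime_card padic) = real CARD('p) powr padic_log x"
  using padic_norm_range[of x] CARD_gt_1[where 'p='p] by (auto simp: padic_log_def)

lemma padic_log_eq: "padic_norm (x :: 'p::prime_card padic) = real CARD('p) powr real_of_int k \<Longrightarrow> padic_log x = k"
  using CARD_gt_1[where 'p='p] by (auto simp: padic_log_def)

lemma padic_norm_prime_powr:
  "padic_norm ((of_nat CARD('p) :: 'p::prime_card padic) powi (- k)) = real CARD('p) powr k"
proof -
  have "padic_abs CARD('p) (of_nat CARD('p)) = inverse (real CARD('p))"
    using padic_abs_of_int_divide[OF prime_card[where 'a='p], of "int CARD('p)" 1] CARD_gt_1[where 'p='p]
      prime_gt_1_nat[OF prime_card[where 'a='p]]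
    by (simp add: power_int_minus multiplicity_self)
  then have "padic_norm (of_rat (of_nat CARD('p)) :: 'p padic) = inverse (real CARD('p))"
    by (simp only: padic_norm_of_rat)
  then have p: "padic_norm (of_nat CARD('p) :: 'p padic) = inverse (real CARD('p))" by simp
  have 1: "padic_norm (1 :: 'p padic) = 1"
    using padic_norm_of_rat[of 1, where 'p='p] by (simp add: prime_card)
  have pow: "padic_norm (x ^ n) = padic_norm x ^ n" for x :: "'p padic" and n
    by (induction n) (simp_all add: 1 padic_norm_mult)
  have inv: "padic_norm (inverse x) = inverse (padic_norm x)" for x :: "'p padic"
  proof (cases "x = 0")
    case False
    then have "padic_norm x * padic_norm (inverse x) = 1" by (simp add: 1 flip: padic_norm_mult)
    then show ?thesis by (metis inverse_unique)
  qed simp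
  show ?thesis
    using CARD_gt_1[where 'p='p]
    by (simp add: power_int_def pow inv p 1 powr_real_of_int')
qed

text \<open>The residue field has at most \<open>p\<close> elements: a \<open>p\<close>-adic integer is congruent to a rational
  \<open>n / d\<close> with \<open>d\<close> prime to \<open>p\<close>, and if \<open>e\<close> inverts \<open>d\<close> modulo \<open>p\<close> then \<open>n / d\<close>
  is congruent to \<open>n e\<close>, hence to the remainder of \<open>n e\<close>.\<close>

lemma padic_residue:
  assumes "padic_norm (x :: 'p::prime_card padic) \<le> 1"
  shows "\<exists>i<CARD('p). padic_norm (x - of_nat i) < 1"
proof -
  let ?p = "CARD('p)"
  have "x \<in> closure (range of_rat)" by (simp add: padic_rat_dense)
  then obtain r where "dist (of_rat r) x < 1"
    unfolding closure_approachable using zero_less_one by blast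
  then have xr: "padic_norm (x - of_rat r) < 1" by (simp add: dist_commute flip: dist_padic_def)
  have "padic_norm (of_rat r :: 'p padic) \<le> 1"
    using padic_norm_ultra[of "of_rat r - x" x] xr assms padic_norm_minus[of "x - of_rat r"] by simp
  then have r1: "padic_abs ?p r \<le> 1" by simp
  obtain n d where q: "quotient_of r = (n, d)" by force
  have d: "d > 0" using quotient_of_denom_pos[OF q] .
  have rn: "r = of_int n / of_int d" using quotient_of_div[OF q] .
  have cop: "coprime n d" using quotient_of_coprime[OF q] .
  have pr: "prime (int ?p)" using prime_card[where 'a='p] by simp
  have p1: "int ?p > 1" using prime_gt_1_nat[OF prime_card[where 'a='p]] by simp
  have ndvd: "\<not> int ?p dvd d"
  proof
    assume dv: "int ?p dvd d"
    then have "\<not> int ?p dvd n" using cop pr by (meson coprime_common_divisor not_prime_unit)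
    then have n0: "n \<noteq> 0" and mn: "multiplicity (int ?p) n = 0" by (auto simp: not_dvd_imp_multiplicity_0)
    have "multiplicity (int ?p) d > 0" using dv d p1 by (simp add: multiplicity_gt_zero_iff)
    then have "padic_abs ?p r > 1"
      unfolding rn padic_abs_of_int_divide[OF prime_card n0 less_imp_neq[OF d, symmetric]] mn
      using CARD_gt_1[where 'p='p] by (simp add: one_less_power_int)
    then show False using r1 by simp
  qed
  then have "coprime d (int ?p)" using pr prime_imp_coprime coprime_commute by blast
  then obtain e where e: "[d * e = 1] (mod int ?p)" using cong_solve_coprime_int by blast
  define i where "i = nat ((n * e) mod int ?p)"
  have i: "int i = (n * e) mod int ?p" using p1 by (simp add: i_def)
  have ip: "i < ?p" using p1 i by (simp add: i_def nat_less_iff)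
  have "[n - d * int i = n - d * (n * e)] (mod int ?p)"
    unfolding i by (intro cong_diff cong_refl cong_mult) (simp add: cong_def)
  also have "n - d * (n * e) = n - n * (d * e)" by (simp add: algebra_simps)
  also have "[n - n * (d * e) = n - n * 1] (mod int ?p)"
    by (intro cong_diff cong_refl cong_mult e)
  finally have dv: "int ?p dvd n - d * int i" by (simp add: cong_0_iff)
  have eq: "r - of_nat i = of_int (n - d * int i) / of_int d" using d by (simp add: rn field_simps)
  have "padic_abs ?p (r - of_nat i) < 1"
  proof (cases "n - d * int i = 0")
    case False
    have "multiplicity (int ?p) (n - d * int i) > 0" using dv False p1 by (simp add: multiplicity_gt_zero_iff)
    moreover have "multiplicity (int ?p) d = 0" using ndvd by (rule not_dvd_imp_multiplicity_0)
    ultimately show ?thesis unfolding eq padic_abs_of_int_divide[OF prime_card False less_imp_neq[OF d, symmetric]]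
      using CARD_gt_1[where 'p='p] by (simp add: power_int_minus power_int_def field_simps)
  qed (simp add: eq)
  then have "padic_norm (of_rat (r - of_nat i) :: 'p padic) < 1" by simp
  then have "padic_norm (of_rat r - of_nat i :: 'p padic) < 1" by (simp add: of_rat_diff)
  then have "padic_norm (x - of_nat i) < 1"
    using padic_norm_ultra[of "x - of_rat r" "of_rat r - of_nat i"] xr by simp
  then show ?thesis using ip by blast
qed

lemma padic_norm_diff_residues:
  assumes "i < CARD('p)" "j < CARD('p)" "i \<noteq> j"
  shows "padic_norm (of_nat i - of_nat j :: 'p::prime_card padic) = 1"
proof -
  have "\<not> int CARD('p) dvd int i - int j"
    using assms dvd_imp_le_int[of "int i - int j" "int CARD('p)"] by auto
  then have "padic_abs CARD('p) (of_int (int i - int j) / of_int 1) = 1"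
    using assms by (subst padic_abs_of_int_divide) (simp_all add: prime_card not_dvd_imp_multiplicity_0)
  then have "padic_norm (of_rat (of_nat i - of_nat j) :: 'p padic) = 1" by simp
  then show ?thesis by (simp add: of_rat_diff)
qed

lemma padic_ball_powr: "padic_ball (a :: 'p::prime_card padic) l = {x. padic_norm (x - a) \<le> real CARD('p) powr l}"
  using CARD_gt_1[where 'p='p] by (simp add: padic_ball_def powr_real_of_int')

lemma padic_norm_less_powr_iff:
  "padic_norm (x :: 'p::prime_card padic) < real CARD('p) powr real_of_int l \<longleftrightarrow> padic_norm x \<le> real CARD('p) powr real_of_int (l - 1)"
proof (cases "x = 0")
  case False
  then show ?thesis using CARD_gt_1[where 'p='p] by (auto simp: padic_norm_eq_powr_log)
qed (use CARD_gt_1[where 'p='p] in auto)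

lemma padic_ball_eq_of_mem: "b \<in> padic_ball a l \<Longrightarrow> padic_ball b l = padic_ball (a :: 'p::prime_card padic) l"
proof -
  have 1: "padic_norm (x - b) \<le> P" if "padic_norm (x - a) \<le> P" "padic_norm (b - a) \<le> P" for x a b :: "'p padic" and P
    using padic_norm_ultra[of "x - a" "a - b"] padic_norm_minus[of "a - b"] that by simp
  assume "b \<in> padic_ball a l"
  then show ?thesis
    unfolding padic_ball_def using 1[of _ a _ b] 1[of _ b _ a] padic_norm_minus[of "a - b"] by auto
qed

text \<open>Rescaling by a power of \<open>p\<close> turns the partition of the integers into \<open>p\<close> residue classes
  into a partition of an arbitrary ball. Together with translation invariance this is what
  determines the Haar measure of all balls.\<close>

lemma padic_ball_split:
  fixes l :: int
  defines "c \<equiv> (of_nat CARD('p) :: 'p::prime_card padic) powi (- l)"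
  shows "padic_ball 0 l = (\<Union>i<CARD('p). padic_ball (of_nat i * c) (l - 1))"
    and "disjoint_family_on (\<lambda>i. padic_ball (of_nat i * c) (l - 1)) {..<CARD('p)}"
proof -
  let ?P = "real CARD('p)"
  have P: "?P > 1" by (rule CARD_gt_1)
  have c: "padic_norm c = ?P powr l" unfolding c_def by (rule padic_norm_prime_powr)
  have c0: "c \<noteq> 0" using c P by auto
  have sm: "padic_ball b (l - 1) = {x. padic_norm (x - b) < ?P powr l}" for b :: "'p padic"
    unfolding padic_ball_powr by (simp only: padic_norm_less_powr_iff)
  have scale: "padic_norm (y * c) = padic_norm y * ?P powr l" for y by (simp add: padic_norm_mult c)
  have ile: "padic_norm (of_nat i :: 'p padic) \<le> 1" if "i < CARD('p)" for i
    using padic_norm_diff_residues[of i 0, where 'p='p] that by (cases "i = 0") auto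
  show "padic_ball 0 l = (\<Union>i<CARD('p). padic_ball (of_nat i * c) (l - 1))"
  proof (intro Set.set_eqI iffI)
    fix x :: "'p padic" assume "x \<in> padic_ball 0 l"
    then have "padic_norm (x / c * c) \<le> ?P powr l" using c0 by (simp add: padic_ball_powr)
    then have "padic_norm (x / c) \<le> 1" unfolding scale using P by simp
    then obtain i where i: "i < CARD('p)" "padic_norm (x / c - of_nat i) < 1" using padic_residue by blast
    then have "padic_norm ((x / c - of_nat i) * c) < ?P powr l" unfolding scale using P by simp
    then have "padic_norm (x - of_nat i * c) < ?P powr l" using c0 by (simp add: algebra_simps)
    then show "x \<in> (\<Union>i<CARD('p). padic_ball (of_nat i * c) (l - 1))" using i sm by auto
  next
    fix x assume "x \<in> (\<Union>i<CARD('p). padic_ball (of_nat i * c) (l - 1))"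
    then obtain i where i: "i < CARD('p)" "padic_norm (x - of_nat i * c) < ?P powr l" using sm by auto
    moreover have "padic_norm (of_nat i * c) \<le> ?P powr l"
      unfolding scale using ile[OF i(1)] P by simp
    ultimately show "x \<in> padic_ball 0 l"
      using padic_norm_ultra[of "x - of_nat i * c" "of_nat i * c"] by (simp add: padic_ball_powr)
  qed
  show "disjoint_family_on (\<lambda>i. padic_ball (of_nat i * c) (l - 1)) {..<CARD('p)}"
    unfolding disjoint_family_on_def
  proof (intro ballI impI equals0I)
    fix i j x assume ij: "i \<in> {..<CARD('p)}" "j \<in> {..<CARD('p)}" "i \<noteq> j"
      and "x \<in> padic_ball (of_nat i * c) (l - 1) \<inter> padic_ball (of_nat j * c) (l - 1)"
    then have x: "padic_norm (x - of_nat i * c) < ?P powr l" "padic_norm (x - of_nat j * c) < ?P powr l"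
      using sm by auto
    have "padic_norm ((of_nat i - of_nat j) * c) = ?P powr l"
      unfolding scale using ij padic_norm_diff_residues[of i j, where 'p='p] by simp
    moreover have "padic_norm (of_nat i * c - x) = padic_norm (x - of_nat i * c)"
      using padic_norm_minus[of "x - of_nat i * c"] by simp
    ultimately show False
      using padic_norm_ultra[of "of_nat i * c - x" "x - of_nat j * c"] x by (simp add: algebra_simps)
  qed
qed

section \<open>Haar measure of balls and spheres\<close>

locale padic_haar_measure =
  fixes M :: "'p::prime_card padic measure" and P :: real
  assumes haar: "padic_haar M" and P_eq: "P = real CARD('p)"
begin

lemma P_gt_1: "1 < P" unfolding P_eq by (rule CARD_gt_1)

lemma sets_M [measurable_cong, simp]: "sets M = sets borel"
  using haar by (simp add: padic_haar_def)

lemma space_M [simp]: "space M = UNIV"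
  using sets_eq_imp_space_eq[OF sets_M] by simp

lemma padic_ball_measurable [measurable, simp]: "padic_ball (a :: 'p padic) l \<in> sets borel"
proof -
  have "padic_ball a l = cball a (P powi l)"
    by (auto simp: padic_ball_def P_eq dist_commute simp flip: dist_padic_def)
  then show ?thesis by simp
qed

lemma emeasure_ball_center: "emeasure M (padic_ball a l) = emeasure M (padic_ball 0 l)"
proof -
  have "padic_ball a l = (\<lambda>x. a + x) ` padic_ball 0 l"
  proof (intro Set.set_eqI iffI)
    fix x assume "x \<in> padic_ball a l"
    then show "x \<in> (\<lambda>x. a + x) ` padic_ball 0 l"
      by (intro image_eqI[of _ _ "x - a"]) (auto simp: padic_ball_def)
  qed (auto simp: padic_ball_def)
  then show ?thesis using haar by (simp add: padic_haar_def)
qed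

lemma emeasure_ball_step: "emeasure M (padic_ball 0 l) = ennreal P * emeasure M (padic_ball 0 (l - 1))"
proof -
  let ?c = "(of_nat CARD('p) :: 'p padic) powi (- l)"
  have "emeasure M (padic_ball 0 l) = (\<Sum>i<CARD('p). emeasure M (padic_ball (of_nat i * ?c) (l - 1)))"
    unfolding padic_ball_split(1)
    by (intro sum_emeasure[symmetric] padic_ball_split(2)) auto
  also have "\<dots> = of_nat CARD('p) * emeasure M (padic_ball 0 (l - 1))"
    by (subst emeasure_ball_center) simp
  finally show ?thesis by (simp add: ennreal_of_nat_eq_real_of_nat P_eq)
qed

lemma emeasure_padic_ball [simp]: "emeasure M (padic_ball a l) = ennreal (P powr l)"
proof -
  have "emeasure M (padic_ball 0 l) = ennreal (P powr l)"
  proof (induction l rule: int_induct[where k = 0])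
    case base
    have "padic_ball 0 0 = {x :: 'p padic. padic_norm x \<le> 1}" by (simp add: padic_ball_def)
    then show ?case using haar P_gt_1 by (simp add: padic_haar_def)
  next
    case (step1 i)
    then show ?case using emeasure_ball_step[of "i + 1"] P_gt_1
      by (simp add: powr_add mult.commute flip: ennreal_mult')
  next
    case (step2 i)
    have "ennreal P * emeasure M (padic_ball 0 (i - 1)) = ennreal P * ennreal (P powr (i - 1))"
      using step2 emeasure_ball_step[of i] P_gt_1 by (simp add: powr_diff flip: ennreal_mult')
    then show ?case using P_gt_1 by (subst (asm) ennreal_mult_cancel_left) auto
  qed
  then show ?thesis unfolding emeasure_ball_center[of a] .
qed

lemma measure_padic_ball [simp]: "measure M (padic_ball a l) = P powr l"
  by (simp add: measure_def)

end

section \<open>Powers of extended nonnegative reals and a power mean inequality\<close>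

lemma ennreal_powr_ennreal [simp]: "0 \<le> x \<Longrightarrow> ennreal_powr (ennreal x) a = ennreal (x powr a)"
  by (simp add: ennreal_powr_def)

lemma ennreal_powr_le_iff:
  assumes "0 < a" "0 \<le> z"
  shows "ennreal_powr y a \<le> ennreal (z powr a) \<longleftrightarrow> y \<le> ennreal z"
proof (cases y)
  case (real x)
  have "x powr a \<le> z powr a \<longleftrightarrow> x \<le> z"
    using assms real by (meson linorder_not_le powr_less_mono2 powr_mono2 less_imp_le)
  then show ?thesis using real assms by simp
qed (simp add: ennreal_powr_def top_unique)

lemma mult_ennreal_powr_inverse_le_iff:
  assumes "0 < r" "0 < c" "0 \<le> z"
  shows "ennreal c * ennreal_powr y (1 / r) \<le> ennreal z \<longleftrightarrow> y \<le> ennreal ((z / c) powr r)"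
proof (cases y)
  case (real x)
  have "ennreal c * ennreal_powr y (1 / r) \<le> ennreal z \<longleftrightarrow> x powr (1 / r) \<le> z / c"
    using assms real by (simp add: field_simps flip: ennreal_mult')
  also have "z / c = ((z / c) powr r) powr (1 / r)" using assms by (simp add: powr_powr)
  also have "x powr (1 / r) \<le> \<dots> \<longleftrightarrow> ennreal_powr (ennreal x) (1 / r) \<le> ennreal (((z / c) powr r) powr (1 / r))"
    using real by simp
  also have "\<dots> \<longleftrightarrow> ennreal x \<le> ennreal ((z / c) powr r)"
    using assms by (intro ennreal_powr_le_iff) auto
  finally show ?thesis using real by simp
qed (use assms in \<open>simp add: ennreal_powr_def top_unique ennreal_mult_top\<close>)

text \<open>The graph of \<open>a \<mapsto> a\<^sup>r\<close> lies above its tangent at \<open>m\<close>, with the negative term of the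
  tangent moved to the other side so that both sides are sums of nonnegative terms and can be
  integrated in the extended nonnegative reals.\<close>

lemma young_tangent:
  fixes a m r :: real
  assumes "1 \<le> r" "0 \<le> a" "0 < m"
  shows "r * m powr (r - 1) * a \<le> a powr r + (r - 1) * m powr r"
proof (cases "a = 0")
  case False
  have "(a powr r) powr (1 / r) * (m powr r) powr (1 - 1 / r) \<le> 1 / r * a powr r + (1 - 1 / r) * m powr r"
    using assms False by (intro Youngs_inequality_0) auto
  also have "(a powr r) powr (1 / r) * (m powr r) powr (1 - 1 / r) = a * m powr (r - 1)"
    using assms by (simp add: powr_powr right_diff_distrib)
  finally have "r * (a * m powr (r - 1)) \<le> r * (1 / r * a powr r + (1 - 1 / r) * m powr r)"
    using assms by (intro mult_left_mono) auto
  then show ?thesis using assms by (simp add: algebra_simps)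
qed (use assms in simp)

text \<open>Jensen's inequality for \<open>x \<mapsto> x\<^sup>r\<close> and weights \<open>u\<close> of total mass \<open>U\<close>: integrate the
  tangent inequality at the mean value \<open>m = S / U\<close>. Below it takes the place of Minkowski's
  inequality.\<close>

lemma nn_integral_weighted_power_mean:
  fixes a :: "'a \<Rightarrow> real" and u :: "'a \<Rightarrow> ennreal"
  assumes [measurable]: "u \<in> borel_measurable N" "a \<in> borel_measurable N"
    and a: "\<And>x. 0 \<le> a x" and r: "1 \<le> r" and nonneg: "0 \<le> U" "0 \<le> S"
    and U: "(\<integral>\<^sup>+x. u x \<partial>N) = ennreal U" and S: "(\<integral>\<^sup>+x. u x * ennreal (a x) \<partial>N) = ennreal S"
  shows "ennreal (S powr r) \<le> ennreal (U powr (r - 1)) * (\<integral>\<^sup>+x. u x * ennreal (a x powr r) \<partial>N)"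
proof (cases "S = 0")
  case False
  have "U \<noteq> 0"
  proof
    assume "U = 0"
    then have "AE x in N. u x = 0" using U by (simp add: nn_integral_0_iff_AE)
    then have "(\<integral>\<^sup>+x. u x * ennreal (a x) \<partial>N) = 0" by (subst nn_integral_0_iff_AE) auto
    then show False using S False nonneg by simp
  qed
  define m where "m = S / U"
  have m: "m > 0" "S = m * U" using False \<open>U \<noteq> 0\<close> nonneg by (auto simp: m_def)
  define I where "I = (\<integral>\<^sup>+x. u x * ennreal (a x powr r) \<partial>N)"
  have "ennreal (r * m powr (r - 1)) * ennreal S = (\<integral>\<^sup>+x. u x * ennreal (r * m powr (r - 1) * a x) \<partial>N)"
    unfolding S[symmetric] using a r m(1)
    by (subst nn_integral_cmult[symmetric]) (auto simp: ennreal_mult' mult_ac intro!: nn_integral_cong)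
  also have "\<dots> \<le> (\<integral>\<^sup>+x. u x * ennreal (a x powr r) + ennreal ((r - 1) * m powr r) * u x \<partial>N)"
  proof (intro nn_integral_mono)
    fix x
    have "ennreal (r * m powr (r - 1) * a x) \<le> ennreal (a x powr r + (r - 1) * m powr r)"
      by (intro ennreal_leI young_tangent a r m)
    then have "u x * ennreal (r * m powr (r - 1) * a x) \<le> u x * ennreal (a x powr r + (r - 1) * m powr r)"
      by (rule mult_left_mono) simp
    also have "\<dots> = u x * ennreal (a x powr r) + ennreal ((r - 1) * m powr r) * u x"
      using r by (simp add: ennreal_plus[symmetric] distrib_left mult.commute del: ennreal_plus) (simp add: distrib_left mult.commute)
    finally show "u x * ennreal (r * m powr (r - 1) * a x) \<le> \<dots>" .
  qed
  also have "\<dots> = I + ennreal ((r - 1) * m powr r) * ennreal U"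
    by (simp add: nn_integral_add nn_integral_cmult U I_def)
  finally have le: "ennreal (r * m powr (r - 1)) * ennreal S \<le> I + ennreal ((r - 1) * m powr r) * ennreal U" .
  have "ennreal (m powr r * U) \<le> I"
  proof (cases I)
    case (real i)
    have "r * m powr (r - 1) * S \<le> i + (r - 1) * m powr r * U"
      using le real r nonneg m by (simp flip: ennreal_mult' ennreal_plus)
    moreover have "r * m powr (r - 1) * S = r * m powr r * U" using m by (simp add: powr_diff)
    ultimately have "r * m powr r * U \<le> i + (r - 1) * m powr r * U" by linarith
    then have "m powr r * U \<le> i" by (simp add: algebra_simps)
    then show ?thesis using real by simp
  qed simp
  then have "ennreal (U powr (r - 1)) * ennreal (m powr r * U) \<le> ennreal (U powr (r - 1)) * I"
    by (rule mult_left_mono) simp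
  moreover have "S powr r = U powr (r - 1) * (m powr r * U)"
    using m nonneg \<open>U \<noteq> 0\<close> by (simp add: powr_mult powr_diff)
  ultimately show ?thesis using nonneg by (simp add: I_def ennreal_mult')
qed (use r in simp)

text \<open>Sums over all integers are written as integrals against the counting measure, which makes
  Tonelli's theorem and monotonicity available in the same form as for the Haar measure.\<close>

lemma nn_integral_int_shift:
  "(\<integral>\<^sup>+k. f (k + n) \<partial>count_space UNIV) = (\<integral>\<^sup>+k. f k \<partial>count_space (UNIV :: int set))"
  by (intro nn_integral_bij_count_space) (auto intro!: bij_betwI[of _ _ _ "\<lambda>k. k - n"])

definition padic_shell :: "int \<Rightarrow> 'p::prime_card padic set" where
  "padic_shell k = {x. x \<noteq> 0 \<and> padic_log x = k}"

lemma padic_norm_shell: "x \<in> padic_shell k \<Longrightarrow> padic_norm (x :: 'p::prime_card padic) = real CARD('p) powr k"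
  by (auto simp: padic_shell_def padic_norm_eq_powr_log)

lemma padic_shell_iff: "x \<in> padic_shell k \<longleftrightarrow> padic_norm (x :: 'p::prime_card padic) = real CARD('p) powr k"
  using padic_log_eq[of x k] CARD_gt_1[where 'p='p] by (auto simp: padic_norm_shell) (auto simp: padic_shell_def)

context padic_haar_measure
begin

section \<open>Integrals of radial functions\<close>

lemma padic_norm_measurable [measurable]: "(padic_norm :: 'p padic \<Rightarrow> real) \<in> borel_measurable borel"
proof -
  have "padic_norm = (\<lambda>x :: 'p padic. dist x 0)" by (simp add: dist_padic_def)
  moreover have "(\<lambda>x :: 'p padic. dist x 0) \<in> borel_measurable borel"
    by (intro borel_measurable_continuous_onI continuous_intros)
  ultimately show ?thesis by simp
qed

lemma padic_log_measurable [measurable]: "(padic_log :: 'p padic \<Rightarrow> int) \<in> measurable borel (count_space UNIV)"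
  unfolding padic_log_def[abs_def] by measurable

lemma padic_shell_measurable [measurable, simp]: "(padic_shell k :: 'p padic set) \<in> sets borel"
  unfolding padic_shell_def by measurable

definition shell_mass :: "'p padic \<Rightarrow> int \<Rightarrow> int \<Rightarrow> ennreal" where
  "shell_mass a l k = emeasure M (padic_ball a l \<inter> padic_shell k)"

text \<open>Either \<open>0\<close> lies in the ball, which is then centred at \<open>0\<close> and contains whole spheres, or
  the absolute value is constant on the ball, which then lies in a single sphere.\<close>

lemma shell_mass_eq:
  "shell_mass a l k =
     (if padic_norm a \<le> P powr l then if k \<le> l then ennreal (P powr k - P powr (k - 1)) else 0
      else if padic_norm a = P powr k then ennreal (P powr l) else 0)"
proof (cases "padic_norm a \<le> P powr l")
  case True
  then have b: "padic_ball a l = padic_ball 0 l"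
    by (intro padic_ball_eq_of_mem) (simp add: padic_ball_powr P_eq)
  show ?thesis
  proof (cases "k \<le> l")
    case kl: True
    have "padic_ball 0 l \<inter> padic_shell k = padic_ball 0 k - (padic_ball 0 (k - 1) :: 'p padic set)"
    proof (intro Set.set_eqI)
      fix x :: "'p padic"
      have "P powr k \<le> P powr l" using kl P_gt_1 by simp
      moreover have "x \<in> padic_ball 0 (k - 1) \<longleftrightarrow> padic_norm x < P powr k"
        by (simp add: padic_ball_powr P_eq padic_norm_less_powr_iff)
      ultimately show "x \<in> padic_ball 0 l \<inter> padic_shell k \<longleftrightarrow> x \<in> padic_ball 0 k - padic_ball 0 (k - 1)"
        by (auto simp: padic_ball_powr padic_shell_iff P_eq[symmetric])
    qed
    moreover have "(padic_ball 0 (k - 1) :: 'p padic set) \<subseteq> padic_ball 0 k"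
      using P_gt_1 by (auto simp: padic_ball_powr P_eq[symmetric] elim!: order_trans)
    ultimately show ?thesis
      using True kl P_gt_1 by (simp add: shell_mass_def b emeasure_Diff ennreal_minus)
  next
    case kl: False
    have "padic_ball 0 l \<inter> padic_shell k = ({} :: 'p padic set)"
      using kl P_gt_1 by (auto simp: padic_ball_powr padic_shell_iff P_eq[symmetric])
    then show ?thesis using True kl by (simp add: shell_mass_def b)
  qed
next
  case False
  have n: "padic_norm x = padic_norm a" if "x \<in> padic_ball a l" for x
  proof (rule padic_norm_eq_of_close)
    show "padic_norm (a - x) < padic_norm a"
      using that False padic_norm_minus[of "a - x"] by (simp add: padic_ball_powr P_eq)
  qed
  then have "padic_ball a l \<inter> padic_shell k = (if padic_norm a = P powr k then padic_ball a l else {})"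
    by (auto simp: padic_shell_iff P_eq[symmetric])
  then show ?thesis using False by (simp add: shell_mass_def)
qed

text \<open>Multiplication by an element \<open>c\<close> of absolute value \<open>p\<^sup>n\<close> maps balls to balls and spheres to
  spheres and multiplies Haar measure by \<open>p\<^sup>n\<close>. For radial functions this is
  the change of variables under a dilation.\<close>

lemma shell_mass_scale:
  assumes "padic_norm c = P powr n"
  shows "shell_mass (c * a) (l + n) (k + n) = ennreal (P powr n) * shell_mass a l k"
proof -
  have P: "P > 0" using P_gt_1 by simp
  have e: "P powr real_of_int (j + n) = P powr n * P powr j" for j using P by (simp add: powr_add)
  have e1: "P powr (real_of_int k + real_of_int n - 1) = P powr n * P powr (real_of_int k - 1)"
    using P by (simp flip: powr_add add: algebra_simps)
  show ?thesis
    unfolding shell_mass_eq padic_norm_mult assms e using P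
    by (auto simp: e1 right_diff_distrib ennreal_mult'[symmetric])
qed

lemma nn_integral_shells:
  assumes [measurable]: "h \<in> borel_measurable M"
  shows "(\<integral>\<^sup>+x\<in>-{0}. h x \<partial>M) = (\<integral>\<^sup>+k. (\<integral>\<^sup>+x\<in>padic_shell k. h x \<partial>M) \<partial>count_space UNIV)"
proof -
  have "(\<integral>\<^sup>+k. (\<integral>\<^sup>+x\<in>padic_shell k. h x \<partial>M) \<partial>count_space UNIV) =
        (\<integral>\<^sup>+x. (\<integral>\<^sup>+k. h x * indicator (padic_shell k) x \<partial>count_space UNIV) \<partial>M)"
    by (intro nn_integral_count_space_nn_integral[symmetric]) auto
  also have "\<dots> = (\<integral>\<^sup>+x\<in>-{0}. h x \<partial>M)"
  proof (intro nn_integral_cong)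
    fix x :: "'p padic"
    have "(\<integral>\<^sup>+k. h x * indicator (padic_shell k) x \<partial>count_space UNIV) =
          (\<integral>\<^sup>+k. (h x * indicator (-{0}) x) * indicator {padic_log x} k \<partial>count_space UNIV)"
      by (intro nn_integral_cong) (auto simp: padic_shell_def indicator_def)
    then show "(\<integral>\<^sup>+k. h x * indicator (padic_shell k) x \<partial>count_space UNIV) = h x * indicator (-{0}) x"
      by (simp add: nn_integral_cmult_indicator)
  qed
  finally show ?thesis ..
qed

lemma nn_integral_ball_radial:
  assumes "g 0 = 0" and g: "\<And>x. x \<noteq> 0 \<Longrightarrow> g x = \<phi> (padic_log x)"
  shows "(\<integral>\<^sup>+x\<in>padic_ball a l. g x \<partial>M) = (\<integral>\<^sup>+k. shell_mass a l k * \<phi> k \<partial>count_space UNIV)"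
proof -
  have [measurable]: "(\<lambda>x :: 'p padic. \<phi> (padic_log x)) \<in> borel_measurable borel"
    using measurable_compose[where g=\<phi> and L=borel, OF padic_log_measurable] by simp
  have "(\<integral>\<^sup>+x\<in>padic_ball a l. g x \<partial>M) = (\<integral>\<^sup>+x\<in>-{0}. (\<phi> (padic_log x) * indicator (padic_ball a l) x) \<partial>M)"
    using assms by (intro nn_integral_cong) (auto simp: indicator_def)
  also have "\<dots> = (\<integral>\<^sup>+k. (\<integral>\<^sup>+x\<in>padic_shell k. (\<phi> (padic_log x) * indicator (padic_ball a l) x) \<partial>M) \<partial>count_space UNIV)"
    by (intro nn_integral_shells) measurable
  also have "\<dots> = (\<integral>\<^sup>+k. shell_mass a l k * \<phi> k \<partial>count_space UNIV)"
  proof (intro nn_integral_cong)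
    fix k
    have "(\<integral>\<^sup>+x\<in>padic_shell k. (\<phi> (padic_log x) * indicator (padic_ball a l) x) \<partial>M) =
          (\<integral>\<^sup>+x. \<phi> k * indicator (padic_ball a l \<inter> padic_shell k) x \<partial>M)"
      by (intro nn_integral_cong) (auto simp: padic_shell_def indicator_def)
    then show "(\<integral>\<^sup>+x\<in>padic_shell k. (\<phi> (padic_log x) * indicator (padic_ball a l) x) \<partial>M) = shell_mass a l k * \<phi> k"
      by (simp add: nn_integral_cmult_indicator shell_mass_def mult.commute)
  qed
  finally show ?thesis .
qed


section \<open>The Cesaro-Morrey norm in terms of integrals over balls\<close>

definition ball_integral :: "('p padic \<Rightarrow> complex) \<Rightarrow> int \<Rightarrow> ennreal" where
  "ball_integral f k = (\<integral>\<^sup>+t\<in>padic_ball 0 k. ennreal (norm (f t)) \<partial>M)"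

definition shell_integral :: "('p padic \<Rightarrow> complex) \<Rightarrow> int \<Rightarrow> ennreal" where
  "shell_integral f k = (\<integral>\<^sup>+t\<in>padic_shell k. ennreal (norm (f t)) \<partial>M)"

lemma sum_shell_integral_le:
  assumes [measurable]: "f \<in> borel_measurable M"
  shows "(\<integral>\<^sup>+j. shell_integral f j * indicator {..k} j \<partial>count_space UNIV) \<le> ball_integral f k"
proof -
  have "(\<integral>\<^sup>+j. shell_integral f j * indicator {..k} j \<partial>count_space UNIV) =
        (\<integral>\<^sup>+j. (\<integral>\<^sup>+t\<in>padic_shell j. (ennreal (norm (f t)) * indicator (padic_ball 0 k) t) \<partial>M) \<partial>count_space UNIV)"
  proof (intro nn_integral_cong)
    fix j
    have "t \<in> padic_ball 0 k \<longleftrightarrow> j \<le> k" if "t \<in> padic_shell j" for t :: "'p padic"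
      using that P_gt_1 by (simp add: padic_shell_iff padic_ball_powr P_eq)
    then have "(\<integral>\<^sup>+t\<in>padic_shell j. (ennreal (norm (f t)) * indicator (padic_ball 0 k) t) \<partial>M) =
        (\<integral>\<^sup>+t. (ennreal (norm (f t)) * indicator (padic_shell j) t) * indicator {..k} j \<partial>M)"
      by (intro nn_integral_cong) (auto simp: indicator_def)
    then show "shell_integral f j * indicator {..k} j =
        (\<integral>\<^sup>+t\<in>padic_shell j. (ennreal (norm (f t)) * indicator (padic_ball 0 k) t) \<partial>M)"
      by (simp add: nn_integral_multc shell_integral_def)
  qed
  also have "\<dots> = (\<integral>\<^sup>+t\<in>-{0}. (ennreal (norm (f t)) * indicator (padic_ball 0 k) t) \<partial>M)"
    by (intro nn_integral_shells[symmetric]) measurable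
  also have "\<dots> \<le> ball_integral f k"
    unfolding ball_integral_def by (intro nn_integral_mono) (auto simp: indicator_def)
  finally show ?thesis .
qed

lemma shell_integral_le_ball_integral: "shell_integral f k \<le> ball_integral f k"
  unfolding shell_integral_def ball_integral_def
  by (intro nn_integral_mono) (auto simp: indicator_def padic_shell_iff padic_ball_powr)

text \<open>The fractional Cesaro mean of \<open>f\<close> is a radial function, with value
  \<open>p\<^sup>-\<^sup>k\<^sup>(\<^sup>1\<^sup>-\<^sup>\<beta>\<^sup>)\<close> times the integral of \<open>|f|\<close> over the ball of radius \<open>p\<^sup>k\<close> on the
  sphere of radius \<open>p\<^sup>k\<close>. At \<open>x = 0\<close> the conventions \<open>1 / 0 = 0\<close> and \<open>0 powr r = 0\<close>
  make the integrand vanish.\<close>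

lemma cesaro_morrey_norm_eq:
  assumes "0 < r"
  shows "cesaro_morrey_norm M \<beta> r q f =
    (SUP a. SUP l. ennreal (P powr (real_of_int l * (1 / q - 1 / r))) *
       ennreal_powr (\<integral>\<^sup>+k. shell_mass a l k *
          ennreal_powr (ennreal (P powr (- real_of_int k * (1 - \<beta>))) * ball_integral f k) r \<partial>count_space UNIV) (1 / r))"
proof -
  define g where "g x = ennreal_powr (ennreal (1 / padic_norm x powr (1 - \<beta>)) *
      (\<integral>\<^sup>+t\<in>{t. padic_norm t \<le> padic_norm x}. ennreal (norm (f t)) \<partial>M)) r" for x :: "'p padic"
  have "(\<integral>\<^sup>+x\<in>padic_ball a l. g x \<partial>M) = (\<integral>\<^sup>+k. shell_mass a l k *
      ennreal_powr (ennreal (P powr (- real_of_int k * (1 - \<beta>))) * ball_integral f k) r \<partial>count_space UNIV)" for a l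
  proof (rule nn_integral_ball_radial)
    show "g 0 = 0" using assms by (simp add: g_def ennreal_powr_def)
    show "g x = ennreal_powr (ennreal (P powr (- real_of_int (padic_log x) * (1 - \<beta>))) * ball_integral f (padic_log x)) r"
      if "x \<noteq> 0" for x
      using that by (simp add: g_def ball_integral_def padic_ball_powr padic_norm_eq_powr_log powr_powr
          powr_minus_divide P_eq)
  qed
  then show ?thesis by (simp add: cesaro_morrey_norm_def g_def powr_powr)
qed

lemma cesaro_morrey_norm_le_iff:
  assumes "0 < r" "0 \<le> N"
  shows "cesaro_morrey_norm M \<beta> r q f \<le> ennreal N \<longleftrightarrow>
    (\<forall>a l. (\<integral>\<^sup>+k. shell_mass a l k *
          ennreal_powr (ennreal (P powr (- real_of_int k * (1 - \<beta>))) * ball_integral f k) r \<partial>count_space UNIV)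
        \<le> ennreal ((N * P powr (real_of_int l * (1 / r - 1 / q))) powr r))"
proof -
  have P: "P > 0" using P_gt_1 by simp
  have e: "N / P powr (real_of_int l * (1 / q - 1 / r)) = N * P powr (real_of_int l * (1 / r - 1 / q))" for l
  proof -
    have "real_of_int l * (1 / r - 1 / q) = - (real_of_int l * (1 / q - 1 / r))" by (simp add: algebra_simps)
    then show ?thesis by (simp only: powr_minus) (simp add: divide_inverse)
  qed
  have pos: "0 < P powr (real_of_int l * (1 / q - 1 / r))" for l using P by simp
  show ?thesis
    unfolding cesaro_morrey_norm_eq[OF assms(1)] SUP_le_iff
    using mult_ennreal_powr_inverse_le_iff[OF assms(1) pos assms(2)] by (simp add: e)
qed

text \<open>Restrict the supremum to a ball of radius \<open>p\<^sup>k\<^sup>-\<^sup>1\<close> inside the sphere of radius \<open>p\<^sup>k\<close>: there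
  the Cesaro mean is constant. This growth bound gives the finiteness needed for convergence, for
  local integrability and for the use of Jensen's inequality.\<close>

lemma ball_integral_bound:
  assumes "0 < r" "0 \<le> N" and le: "cesaro_morrey_norm M \<beta> r q f \<le> ennreal N"
  shows "ball_integral f k \<le> ennreal (N * P powr (1 / q) * P powr (k * (1 - \<beta> - 1 / q)))"
proof -
  have P: "P > 0" "P > 1" using P_gt_1 by auto
  define a :: "'p padic" where "a = of_nat CARD('p) powi (- k)"
  have a: "padic_norm a = P powr k" unfolding a_def P_eq by (rule padic_norm_prime_powr)
  define Y where "Y = ennreal (P powr (- real_of_int k * (1 - \<beta>))) * ball_integral f k"
  define Z where "Z = N * P powr (real_of_int (k - 1) * (1 / r - 1 / q))"
  have Z: "Z \<ge> 0" using assms by (simp add: Z_def)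
  have sm: "shell_mass a (k - 1) k = ennreal (P powr (k - 1))"
    using P by (simp add: shell_mass_eq a)
  have "ennreal (P powr (k - 1)) * ennreal_powr Y r =
      (\<integral>\<^sup>+j. (shell_mass a (k - 1) j * ennreal_powr (ennreal (P powr (- real_of_int j * (1 - \<beta>))) * ball_integral f j) r)
         * indicator {k} j \<partial>count_space UNIV)"
    by (simp add: Y_def sm)
  also have "\<dots> \<le> (\<integral>\<^sup>+j. shell_mass a (k - 1) j * ennreal_powr (ennreal (P powr (- real_of_int j * (1 - \<beta>))) * ball_integral f j) r
         \<partial>count_space UNIV)"
    by (intro nn_integral_mono) (auto simp: indicator_def)
  also have "\<dots> \<le> ennreal (Z powr r)"
    using le[unfolded cesaro_morrey_norm_le_iff[OF assms(1,2)]] unfolding Z_def by blast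
  finally have "ennreal (P powr (- real_of_int (k - 1))) * (ennreal (P powr (k - 1)) * ennreal_powr Y r) \<le>
      ennreal (P powr (- real_of_int (k - 1))) * ennreal (Z powr r)"
    by (rule mult_left_mono) simp
  also have "ennreal (P powr (- real_of_int (k - 1))) * (ennreal (P powr (k - 1)) * ennreal_powr Y r) = ennreal_powr Y r"
    using P by (simp flip: mult.assoc ennreal_mult' powr_add)
  also have "ennreal (P powr (- real_of_int (k - 1))) * ennreal (Z powr r) =
      ennreal ((N * P powr (- (real_of_int (k - 1) / q))) powr r)"
  proof -
    have "P powr (- real_of_int (k - 1)) = (P powr (- real_of_int (k - 1) / r)) powr r"
      using assms by (simp add: powr_powr)
    also have "\<dots> * Z powr r = (P powr (- real_of_int (k - 1) / r) * Z) powr r"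
      using Z by (simp add: powr_mult)
    also have "P powr (- real_of_int (k - 1) / r) * Z = N * P powr (- (real_of_int (k - 1) / q))"
      unfolding Z_def using P by (simp flip: powr_add add: algebra_simps diff_divide_distrib)
    finally show ?thesis by (simp flip: ennreal_mult')
  qed
  finally have "Y \<le> ennreal (N * P powr (- (real_of_int (k - 1) / q)))"
    using assms by (subst (asm) ennreal_powr_le_iff) auto
  then have "ennreal (P powr (real_of_int k * (1 - \<beta>))) * Y \<le>
      ennreal (P powr (real_of_int k * (1 - \<beta>))) * ennreal (N * P powr (- (real_of_int (k - 1) / q)))"
    by (rule mult_left_mono) simp
  also have "ennreal (P powr (real_of_int k * (1 - \<beta>))) * Y = ball_integral f k"
    unfolding Y_def using P by (simp flip: mult.assoc ennreal_mult' powr_add)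
  also have "ennreal (P powr (real_of_int k * (1 - \<beta>))) * ennreal (N * P powr (- (real_of_int (k - 1) / q))) =
      ennreal (N * P powr (1 / q) * P powr (k * (1 - \<beta> - 1 / q)))"
  proof -
    have "P powr (real_of_int k * (1 - \<beta>)) * P powr (- (real_of_int (k - 1) / q)) =
        P powr (1 / q) * P powr (k * (1 - \<beta> - 1 / q))"
      unfolding powr_add[symmetric] by (simp add: algebra_simps diff_divide_distrib)
    then show ?thesis by (simp flip: ennreal_mult' add: mult_ac)
  qed
  finally show ?thesis .
qed

section \<open>Operators with kernels that depend only on absolute values\<close>

definition radial_kernel :: "(int \<Rightarrow> real) \<Rightarrow> 'p padic \<Rightarrow> 'p padic \<Rightarrow> real" where
  "radial_kernel w s t = (if s = 0 \<or> t = 0 then 0 else w (padic_log t - padic_log s) / padic_norm t)"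

definition radial_operator :: "(int \<Rightarrow> real) \<Rightarrow> ('p padic \<Rightarrow> complex) \<Rightarrow> 'p padic \<Rightarrow> complex" where
  "radial_operator w f s = (LINT t|M. radial_kernel w s t *\<^sub>R f t)"

lemma radial_kernel_measurable [measurable]: "radial_kernel w s \<in> borel_measurable borel"
proof -
  have [measurable]: "(\<lambda>t :: 'p padic. w (padic_log t - padic_log s)) \<in> borel_measurable borel"
    using measurable_compose[where g="\<lambda>n. w (n - padic_log s)" and L=borel, OF padic_log_measurable] by simp
  show ?thesis unfolding radial_kernel_def[abs_def] by measurable
qed

lemma nn_integral_radial_kernel:
  assumes [measurable]: "f \<in> borel_measurable M" and w: "\<And>n. 0 \<le> w n" and s: "s \<noteq> 0"
  shows "(\<integral>\<^sup>+t. ennreal (norm (radial_kernel w s t *\<^sub>R f t)) \<partial>M) =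
    (\<integral>\<^sup>+n. ennreal (w n * P powr (- real_of_int (padic_log s + n))) * shell_integral f (padic_log s + n) \<partial>count_space UNIV)"
proof -
  let ?v = "\<lambda>j. ennreal (w (j - padic_log s) * P powr (- real_of_int j))"
  have "(\<integral>\<^sup>+t. ennreal (norm (radial_kernel w s t *\<^sub>R f t)) \<partial>M) =
      (\<integral>\<^sup>+t\<in>-{0}. ennreal (norm (radial_kernel w s t *\<^sub>R f t)) \<partial>M)"
    by (intro nn_integral_cong) (auto simp: indicator_def radial_kernel_def)
  also have "\<dots> = (\<integral>\<^sup>+j. (\<integral>\<^sup>+t\<in>padic_shell j. ennreal (norm (radial_kernel w s t *\<^sub>R f t)) \<partial>M) \<partial>count_space UNIV)"
    by (intro nn_integral_shells) measurable
  also have "\<dots> = (\<integral>\<^sup>+j. ?v j * shell_integral f j \<partial>count_space UNIV)"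
  proof (intro nn_integral_cong)
    fix j
    have "(\<integral>\<^sup>+t\<in>padic_shell j. ennreal (norm (radial_kernel w s t *\<^sub>R f t)) \<partial>M) =
        (\<integral>\<^sup>+t. ?v j * (ennreal (norm (f t)) * indicator (padic_shell j) t) \<partial>M)"
    proof (intro nn_integral_cong)
      fix t :: "'p padic"
      show "ennreal (norm (radial_kernel w s t *\<^sub>R f t)) * indicator (padic_shell j) t =
          ?v j * (ennreal (norm (f t)) * indicator (padic_shell j) t)"
        using s w[of "j - padic_log s"]
        by (auto simp: indicator_def radial_kernel_def padic_shell_def padic_norm_eq_powr_log P_eq
            powr_minus_divide simp flip: ennreal_mult')
    qed
    then show "(\<integral>\<^sup>+t\<in>padic_shell j. ennreal (norm (radial_kernel w s t *\<^sub>R f t)) \<partial>M) = ?v j * shell_integral f j"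
      by (simp add: nn_integral_cmult shell_integral_def)
  qed
  also have "\<dots> = (\<integral>\<^sup>+n. ?v (n + padic_log s) * shell_integral f (n + padic_log s) \<partial>count_space UNIV)"
    by (rule nn_integral_int_shift[symmetric])
  finally show ?thesis by (simp add: add.commute)
qed

text \<open>For \<open>\<delta> = \<beta> + 1/q\<close> the term with index \<open>n\<close> bounds the norm of the part of the radial
  operator that comes from the pairs with \<open>|t| = p\<^sup>n |s|\<close>.\<close>

definition kernel_sum :: "(int \<Rightarrow> real) \<Rightarrow> real \<Rightarrow> ennreal" where
  "kernel_sum w \<delta> = (\<integral>\<^sup>+n. ennreal (w n * P powr (- real_of_int n * \<delta>)) \<partial>count_space UNIV)"

lemma integrable_radial_kernel:
  assumes [measurable]: "f \<in> borel_measurable M" and w: "\<And>n. 0 \<le> w n" and s: "s \<noteq> 0" and "0 < r"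
    and fin: "cesaro_morrey_norm M \<beta> r q f < \<infinity>" and sum: "kernel_sum w (\<beta> + 1 / q) < \<infinity>"
  shows "integrable M (\<lambda>t. radial_kernel w s t *\<^sub>R f t)"
proof (rule integrableI_bounded)
  obtain N where N: "0 \<le> N" "cesaro_morrey_norm M \<beta> r q f = ennreal N"
    using fin by (cases "cesaro_morrey_norm M \<beta> r q f") auto
  define k where "k = padic_log s"
  define C where "C = N * P powr (1 / q) * P powr (- real_of_int k * (\<beta> + 1 / q))"
  have "(\<integral>\<^sup>+t. ennreal (norm (radial_kernel w s t *\<^sub>R f t)) \<partial>M) \<le>
      (\<integral>\<^sup>+n. ennreal C * ennreal (w n * P powr (- real_of_int n * (\<beta> + 1 / q))) \<partial>count_space UNIV)"
    unfolding nn_integral_radial_kernel[OF assms(1) w s] k_def[symmetric]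
  proof (intro nn_integral_mono)
    fix n
    have "shell_integral f (k + n) \<le> ennreal (N * P powr (1 / q) * P powr (real_of_int (k + n) * (1 - \<beta> - 1 / q)))"
      using shell_integral_le_ball_integral ball_integral_bound[OF \<open>0 < r\<close> N(1) eq_refl[OF N(2)]]
      by (rule order_trans)
    then have "ennreal (w n * P powr (- real_of_int (k + n))) * shell_integral f (k + n) \<le>
        ennreal (w n * P powr (- real_of_int (k + n))) *
        ennreal (N * P powr (1 / q) * P powr (real_of_int (k + n) * (1 - \<beta> - 1 / q)))"
      by (rule mult_left_mono) simp
    also have "\<dots> = ennreal C * ennreal (w n * P powr (- real_of_int n * (\<beta> + 1 / q)))"
    proof -
      have "P powr (- real_of_int (k + n)) * P powr (real_of_int (k + n) * (1 - \<beta> - 1 / q)) =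
          P powr (- real_of_int k * (\<beta> + 1 / q)) * P powr (- real_of_int n * (\<beta> + 1 / q))"
        unfolding powr_add[symmetric] by (simp add: algebra_simps)
      then show ?thesis using N w by (simp flip: ennreal_mult' add: C_def mult_ac)
    qed
    finally show "ennreal (w n * P powr (- real_of_int (k + n))) * shell_integral f (k + n) \<le> \<dots>" .
  qed
  also have "\<dots> = ennreal C * kernel_sum w (\<beta> + 1 / q)"
    unfolding kernel_sum_def by (rule nn_integral_cmult) simp
  also have "\<dots> < \<infinity>" using sum by (simp add: ennreal_mult_less_top)
  finally show "(\<integral>\<^sup>+t. ennreal (norm (radial_kernel w s t *\<^sub>R f t)) \<partial>M) < \<infinity>" .
qed measurable

text \<open>This makes the image measurable, because every function of the integer-valued logarithm is
  measurable.\<close>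

lemma radial_operator_radial: "\<exists>h. \<forall>s. s \<noteq> 0 \<longrightarrow> radial_operator w f s = h (padic_log s)"
  unfolding radial_operator_def radial_kernel_def
  by (intro exI[of _ "\<lambda>k. LINT t|M. (if t = 0 then 0 else w (padic_log t - k) / padic_norm t) *\<^sub>R f t"]) simp

lemma radial_operator_0 [simp]: "radial_operator w f 0 = 0"
  by (simp add: radial_operator_def radial_kernel_def)

lemma radial_operator_measurable [measurable]: "radial_operator w f \<in> borel_measurable borel"
proof -
  obtain h where h: "\<And>s. s \<noteq> 0 \<Longrightarrow> radial_operator w f s = h (padic_log s)"
    using radial_operator_radial by blast
  have [measurable]: "(\<lambda>s :: 'p padic. h (padic_log s)) \<in> borel_measurable borel"
    using measurable_compose[where g=h and L=borel, OF padic_log_measurable] by simp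
  have "radial_operator w f = (\<lambda>s. if s = 0 then 0 else h (padic_log s))" using h by auto
  then show ?thesis by simp
qed

lemma norm_radial_operator_le:
  assumes [measurable]: "f \<in> borel_measurable M" and w: "\<And>n. 0 \<le> w n" and s: "s \<noteq> 0"
  shows "ennreal (norm (radial_operator w f s)) \<le>
    (\<integral>\<^sup>+n. ennreal (w n * P powr (- real_of_int (padic_log s + n))) * shell_integral f (padic_log s + n) \<partial>count_space UNIV)"
proof (cases "integrable M (\<lambda>t. radial_kernel w s t *\<^sub>R f t)")
  case True
  then show ?thesis
    unfolding nn_integral_radial_kernel[OF assms, symmetric] radial_operator_def
    by (rule integral_norm_bound_ennreal)
qed (simp add: radial_operator_def not_integrable_integral_eq)

text \<open>The operator acts as a convolution on the integers: on the sphere of radius \<open>p\<^sup>j\<close> the image is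
  bounded by the sum over \<open>n\<close> of \<open>w n p\<^sup>-\<^sup>j\<^sup>-\<^sup>n\<close> times the integral of \<open>|f|\<close> over the sphere of
  radius \<open>p\<^sup>j\<^sup>+\<^sup>n\<close>. The sphere of integration has measure at most \<open>p\<^sup>j\<close>, which leaves
  \<open>p\<^sup>-\<^sup>n\<close>, and the spheres with \<open>j \<le> k\<close> are shifted into the ball of radius
  \<open>p\<^sup>k\<^sup>+\<^sup>n\<close>.\<close>

lemma ball_integral_radial_operator_le:
  assumes [measurable]: "f \<in> borel_measurable M" and w: "\<And>n. 0 \<le> w n"
  shows "ball_integral (radial_operator w f) k \<le>
    (\<integral>\<^sup>+n. ennreal (w n * P powr (- real_of_int n)) * ball_integral f (k + n) \<partial>count_space UNIV)"
proof -
  let ?b = "\<lambda>j. \<integral>\<^sup>+n. ennreal (w n * P powr (- real_of_int (j + n))) * shell_integral f (j + n) \<partial>count_space UNIV"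
  have P: "P > 0" using P_gt_1 by simp
  have "ball_integral (radial_operator w f) k \<le>
      (\<integral>\<^sup>+s\<in>padic_ball 0 k. (if s = 0 then 0 else ?b (padic_log s)) \<partial>M)"
    unfolding ball_integral_def
  proof (intro nn_integral_mono)
    fix s
    show "ennreal (norm (radial_operator w f s)) * indicator (padic_ball 0 k) s \<le>
        (if s = 0 then 0 else ?b (padic_log s)) * indicator (padic_ball 0 k) s"
      using norm_radial_operator_le[OF assms, of s] by (auto simp: indicator_def)
  qed
  also have "\<dots> = (\<integral>\<^sup>+j. shell_mass 0 k j * ?b j \<partial>count_space UNIV)"
    by (rule nn_integral_ball_radial) auto
  also have "\<dots> \<le> (\<integral>\<^sup>+j. (\<integral>\<^sup>+n. ennreal (w n * P powr (- real_of_int n)) * (shell_integral f (j + n) * indicator {..k} j)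
        \<partial>count_space UNIV) \<partial>count_space UNIV)"
  proof (intro nn_integral_mono)
    fix j
    have "shell_mass 0 k j \<le> ennreal (P powr j) * indicator {..k} j"
      using P by (auto simp: shell_mass_eq indicator_def intro!: ennreal_leI)
    then have "shell_mass 0 k j * ?b j \<le> (ennreal (P powr j) * indicator {..k} j) * ?b j"
      by (rule mult_right_mono) simp
    also have "\<dots> = (\<integral>\<^sup>+n. (ennreal (P powr j) * indicator {..k} j) *
        (ennreal (w n * P powr (- real_of_int (j + n))) * shell_integral f (j + n)) \<partial>count_space UNIV)"
      by (rule nn_integral_cmult[symmetric]) simp
    also have "\<dots> = (\<integral>\<^sup>+n. ennreal (w n * P powr (- real_of_int n)) * (shell_integral f (j + n) * indicator {..k} j) \<partial>count_space UNIV)"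
    proof (intro nn_integral_cong)
      fix n
      have "P powr j * P powr (- real_of_int (j + n)) = P powr (- real_of_int n)"
        unfolding powr_add[symmetric] by simp
      then have "w n * P powr (- real_of_int n) = P powr j * (w n * P powr (- real_of_int (j + n)))"
        by (simp only: mult.left_commute[of _ "w n"])
      then have "ennreal (w n * P powr (- real_of_int n)) = ennreal (P powr j) * ennreal (w n * P powr (- real_of_int (j + n)))"
        by (simp only: ennreal_mult' powr_ge_zero)
      then show "(ennreal (P powr j) * indicator {..k} j) * (ennreal (w n * P powr (- real_of_int (j + n))) * shell_integral f (j + n)) =
          ennreal (w n * P powr (- real_of_int n)) * (shell_integral f (j + n) * indicator {..k} j)"
        by (simp only: mult_ac)
    qed
    finally show "shell_mass 0 k j * ?b j \<le> \<dots>" .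
  qed
  also have "\<dots> = (\<integral>\<^sup>+n. (\<integral>\<^sup>+j. ennreal (w n * P powr (- real_of_int n)) * (shell_integral f (j + n) * indicator {..k} j)
        \<partial>count_space UNIV) \<partial>count_space UNIV)"
    by (rule nn_integral_count_space_nn_integral) auto
  also have "\<dots> \<le> (\<integral>\<^sup>+n. ennreal (w n * P powr (- real_of_int n)) * ball_integral f (k + n) \<partial>count_space UNIV)"
  proof (intro nn_integral_mono)
    fix n
    have "(\<integral>\<^sup>+j. shell_integral f (j + n) * indicator {..k} j \<partial>count_space UNIV) =
        (\<integral>\<^sup>+j. shell_integral f (j + n) * indicator {..k + n} (j + n) \<partial>count_space UNIV)"
      by (intro nn_integral_cong) (auto simp: indicator_def)
    also have "\<dots> = (\<integral>\<^sup>+j. shell_integral f j * indicator {..k + n} j \<partial>count_space UNIV)"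
      by (rule nn_integral_int_shift)
    also have "\<dots> \<le> ball_integral f (k + n)" by (rule sum_shell_integral_le) fact
    finally show "(\<integral>\<^sup>+j. ennreal (w n * P powr (- real_of_int n)) * (shell_integral f (j + n) * indicator {..k} j) \<partial>count_space UNIV)
        \<le> ennreal (w n * P powr (- real_of_int n)) * ball_integral f (k + n)"
      by (subst nn_integral_cmult) (auto intro!: mult_left_mono)
  qed
  finally show ?thesis .
qed


section \<open>Boundedness of radial operators\<close>

text \<open>By the convolution estimate the Cesaro mean of the image is at most the sum over \<open>n\<close> of
  \<open>u n\<close> times \<open>a k n\<close>, where \<open>a k n = p\<^sup>n\<^sup>/\<^sup>q b (k + n)\<close> is the Cesaro mean \<open>b\<close> of \<open>f\<close>
  dilated so as to keep its Morrey norm: the image of a ball under dilation is a ball, so the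
  dilated mean satisfies the same Morrey estimate on every ball. Jensen's inequality
  for the weights \<open>u\<close> and Tonelli's theorem then yield the constant \<open>U\<close>, the sum of \<open>u\<close>.\<close>

lemma cesaro_morrey_norm_radial_operator_le:
  assumes [measurable]: "f \<in> borel_measurable M" and w: "\<And>n. 0 \<le> w n" and r: "1 \<le> r"
    and N: "0 \<le> N" "cesaro_morrey_norm M \<beta> r q f \<le> ennreal N"
    and U: "0 \<le> U" "kernel_sum w (\<beta> + 1 / q) = ennreal U"
  shows "cesaro_morrey_norm M \<beta> r q (radial_operator w f) \<le> ennreal (U * N)"
proof -
  have P: "P > 0" using P_gt_1 by simp
  have r0: "0 < r" using r by simp
  define u where "u n = ennreal (w n * P powr (- real_of_int n * (\<beta> + 1 / q)))" for n
  define b where "b k = P powr (- real_of_int k * (1 - \<beta>)) * enn2real (ball_integral f k)" for k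
  have fin: "ball_integral f k < \<infinity>" for k
    using ball_integral_bound[OF r0 N] by (rule le_less_trans) simp
  then have bi: "ball_integral f k = ennreal (enn2real (ball_integral f k))" for k
    using fin[of k] by simp
  have b: "ennreal (P powr (- real_of_int k * (1 - \<beta>))) * ball_integral f k = ennreal (b k)" for k
    unfolding b_def by (subst bi) (simp add: ennreal_mult')
  have b0: "0 \<le> b k" for k by (simp add: b_def)
  have b_le: "b k \<le> N * P powr (1 / q) * P powr (- (real_of_int k / q))" for k
  proof -
    have "enn2real (ball_integral f k) \<le> N * P powr (1 / q) * P powr (real_of_int k * (1 - \<beta> - 1 / q))"
      using ball_integral_bound[OF r0 N, of k] N by (intro enn2real_leI) auto
    then have "b k \<le> P powr (- real_of_int k * (1 - \<beta>)) * (N * P powr (1 / q) * P powr (real_of_int k * (1 - \<beta> - 1 / q)))"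
      unfolding b_def by (rule mult_left_mono) simp
    also have "\<dots> = N * P powr (1 / q) * P powr (- (real_of_int k / q))"
    proof -
      have "P powr (- real_of_int k * (1 - \<beta>)) * P powr (real_of_int k * (1 - \<beta> - 1 / q)) = P powr (- (real_of_int k / q))"
        unfolding powr_add[symmetric] by (simp add: algebra_simps)
      then show ?thesis by (metis mult.left_commute)
    qed
    finally show ?thesis .
  qed
  define a where "a k n = P powr (real_of_int n / q) * b (k + n)" for k n
  have a0: "0 \<le> a k n" for k n by (simp add: a_def b0)
  have sum_u: "(\<integral>\<^sup>+n. u n \<partial>count_space UNIV) = ennreal U"
    using U by (simp add: u_def kernel_sum_def)
  have conv: "ennreal (P powr (- real_of_int k * (1 - \<beta>))) * ball_integral (radial_operator w f) k
      \<le> (\<integral>\<^sup>+n. u n * ennreal (a k n) \<partial>count_space UNIV)" for k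
  proof -
    have "ennreal (P powr (- real_of_int k * (1 - \<beta>))) * ball_integral (radial_operator w f) k \<le>
        ennreal (P powr (- real_of_int k * (1 - \<beta>))) *
          (\<integral>\<^sup>+n. ennreal (w n * P powr (- real_of_int n)) * ball_integral f (k + n) \<partial>count_space UNIV)"
      by (intro mult_left_mono ball_integral_radial_operator_le w) auto
    also have "\<dots> = (\<integral>\<^sup>+n. ennreal (P powr (- real_of_int k * (1 - \<beta>))) *
          (ennreal (w n * P powr (- real_of_int n)) * ball_integral f (k + n)) \<partial>count_space UNIV)"
      by (rule nn_integral_cmult[symmetric]) simp
    also have "\<dots> = (\<integral>\<^sup>+n. u n * ennreal (a k n) \<partial>count_space UNIV)"
    proof (intro nn_integral_cong)
      fix n
      have "P powr (- real_of_int k * (1 - \<beta>)) * P powr (- real_of_int n) =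
          P powr (- real_of_int n * (\<beta> + 1 / q)) * P powr (real_of_int n / q) * P powr (- real_of_int (k + n) * (1 - \<beta>))"
        (is "?A * ?B = ?C * ?D * ?E")
        unfolding powr_add[symmetric] by (simp add: algebra_simps)
      then have "(?A * ?B) * (w n * x) = (?C * ?D * ?E) * (w n * x)" for x by simp
      moreover have "?A * (w n * ?B * x) = (?A * ?B) * (w n * x)" for x by (simp only: mult_ac)
      moreover have "(?C * ?D * ?E) * (w n * x) = (w n * ?C) * (?D * (?E * x))" for x by (simp only: mult_ac)
      ultimately have eq: "?A * (w n * ?B * enn2real (ball_integral f (k + n))) = (w n * ?C) * a k n"
        unfolding a_def b_def by metis
      have "ennreal ?A * (ennreal (w n * ?B) * ball_integral f (k + n)) =
          ennreal (?A * (w n * ?B * enn2real (ball_integral f (k + n))))"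
        using w[of n] by (subst bi) (simp add: ennreal_mult')
      also have "\<dots> = u n * ennreal (a k n)"
        unfolding eq u_def using w[of n] by (simp add: ennreal_mult')
      finally show "ennreal ?A * (ennreal (w n * ?B) * ball_integral f (k + n)) = u n * ennreal (a k n)" .
    qed
    finally show ?thesis .
  qed
  have pow: "ennreal_powr (ennreal (P powr (- real_of_int k * (1 - \<beta>))) * ball_integral (radial_operator w f) k) r
      \<le> ennreal (U powr (r - 1)) * (\<integral>\<^sup>+n. u n * ennreal (a k n powr r) \<partial>count_space UNIV)" for k
  proof -
    \<comment> \<open>By the growth bound \<open>a k n\<close> is bounded in \<open>n\<close>, so its weighted sum \<open>S\<close> is finite.\<close>
    have "(\<integral>\<^sup>+n. u n * ennreal (a k n) \<partial>count_space UNIV) \<le>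
        (\<integral>\<^sup>+n. u n * ennreal (N * P powr (1 / q) * P powr (- (real_of_int k / q))) \<partial>count_space UNIV)"
    proof (intro nn_integral_mono mult_left_mono ennreal_leI)
      fix n
      have "a k n \<le> P powr (real_of_int n / q) * (N * P powr (1 / q) * P powr (- (real_of_int (k + n) / q)))"
        unfolding a_def by (intro mult_left_mono b_le) simp
      also have "\<dots> = N * P powr (1 / q) * P powr (- (real_of_int k / q))"
      proof -
        have "P powr (real_of_int n / q) * P powr (- (real_of_int (k + n) / q)) = P powr (- (real_of_int k / q))"
          unfolding powr_add[symmetric] by (simp add: add_divide_distrib)
        then show ?thesis by (metis mult.left_commute)
      qed
      finally show "a k n \<le> N * P powr (1 / q) * P powr (- (real_of_int k / q))" .
    qed auto
    also have "\<dots> = ennreal U * ennreal (N * P powr (1 / q) * P powr (- (real_of_int k / q)))"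
      by (subst nn_integral_multc) (simp_all add: sum_u)
    also have "\<dots> < \<infinity>" by (simp add: ennreal_mult_less_top)
    finally obtain S where S: "0 \<le> S" "(\<integral>\<^sup>+n. u n * ennreal (a k n) \<partial>count_space UNIV) = ennreal S"
      by (cases "\<integral>\<^sup>+n. u n * ennreal (a k n) \<partial>count_space UNIV") auto
    have "ennreal_powr (ennreal (P powr (- real_of_int k * (1 - \<beta>))) * ball_integral (radial_operator w f) k) r
        \<le> ennreal (S powr r)"
      using conv[of k] S r0 by (subst ennreal_powr_le_iff) auto
    also have "\<dots> \<le> ennreal (U powr (r - 1)) * (\<integral>\<^sup>+n. u n * ennreal (a k n powr r) \<partial>count_space UNIV)"
      by (rule nn_integral_weighted_power_mean[OF _ _ a0 r U(1) S(1) sum_u S(2)]) auto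
    finally show ?thesis .
  qed
  \<comment> \<open>The Morrey estimate for the Cesaro mean of \<open>f\<close> itself.\<close>
  have hyp: "(\<integral>\<^sup>+k. shell_mass c l k * ennreal (b k powr r) \<partial>count_space UNIV) \<le>
      ennreal ((N * P powr (real_of_int l * (1 / r - 1 / q))) powr r)" for c l
    using N(2)[unfolded cesaro_morrey_norm_le_iff[OF r0 N(1)] b ennreal_powr_ennreal[OF b0]] by blast
  \<comment> \<open>The same estimate for the dilated mean, on the dilated ball \<open>d B\<close> with \<open>|d| = p\<^sup>n\<close>.\<close>
  have shifted: "(\<integral>\<^sup>+k. shell_mass c l k * ennreal (a k n powr r) \<partial>count_space UNIV) \<le>
      ennreal ((N * P powr (real_of_int l * (1 / r - 1 / q))) powr r)" for c l n
  proof -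
    define d :: "'p padic" where "d = of_nat CARD('p) powi (- n)"
    have d: "padic_norm d = P powr n" unfolding d_def P_eq by (rule padic_norm_prime_powr)
    let ?c = "ennreal (P powr (real_of_int n * (r / q - 1)))"
    have "(\<integral>\<^sup>+k. shell_mass c l k * ennreal (a k n powr r) \<partial>count_space UNIV) =
        (\<integral>\<^sup>+k. ?c * (shell_mass (d * c) (l + n) (k + n) * ennreal (b (k + n) powr r)) \<partial>count_space UNIV)"
    proof (intro nn_integral_cong)
      fix k
      have "a k n powr r = P powr (real_of_int n * (r / q - 1)) * P powr n * b (k + n) powr r"
      proof -
        have "(P powr (real_of_int n / q)) powr r = P powr (real_of_int n * (r / q - 1)) * P powr n"
          unfolding powr_powr powr_add[symmetric] by (simp add: algebra_simps)
        then show ?thesis by (simp only: a_def powr_mult)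
      qed
      then show "shell_mass c l k * ennreal (a k n powr r) =
          ?c * (shell_mass (d * c) (l + n) (k + n) * ennreal (b (k + n) powr r))"
        unfolding shell_mass_scale[OF d] by (simp add: ennreal_mult' mult_ac)
    qed
    also have "\<dots> = ?c * (\<integral>\<^sup>+k. shell_mass (d * c) (l + n) (k + n) * ennreal (b (k + n) powr r) \<partial>count_space UNIV)"
      by (rule nn_integral_cmult) simp
    also have "\<dots> = ?c * (\<integral>\<^sup>+k. shell_mass (d * c) (l + n) k * ennreal (b k powr r) \<partial>count_space UNIV)"
      by (subst nn_integral_int_shift[where f="\<lambda>k. shell_mass (d * c) (l + n) k * ennreal (b k powr r)"]) simp
    also have "\<dots> \<le> ?c * ennreal ((N * P powr (real_of_int (l + n) * (1 / r - 1 / q))) powr r)"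
      by (intro mult_left_mono hyp) simp
    also have "\<dots> = ennreal ((N * P powr (real_of_int l * (1 / r - 1 / q))) powr r)"
    proof -
      let ?X = "P powr (real_of_int n * (1 / q - 1 / r))"
      let ?Y = "P powr (real_of_int (l + n) * (1 / r - 1 / q))"
      have "P powr (real_of_int n * (r / q - 1)) = ?X powr r"
        unfolding powr_powr using r0 by (simp add: algebra_simps)
      then have "P powr (real_of_int n * (r / q - 1)) * (N * ?Y) powr r = (?X * (N * ?Y)) powr r"
        using N(1) by (simp only: powr_mult powr_ge_zero mult_nonneg_nonneg)
      moreover have "?X * ?Y = P powr (real_of_int l * (1 / r - 1 / q))"
        unfolding powr_add[symmetric] by (simp add: algebra_simps)
      ultimately show ?thesis
        by (simp only: mult.left_commute[of ?X N] ennreal_mult'[symmetric] powr_ge_zero)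
    qed
    finally show ?thesis .
  qed
  show ?thesis
    unfolding cesaro_morrey_norm_le_iff[OF r0 mult_nonneg_nonneg[OF U(1) N(1)]]
  proof (intro allI)
    fix c :: "'p padic" and l
    let ?R = "ennreal ((N * P powr (real_of_int l * (1 / r - 1 / q))) powr r)"
    have "(\<integral>\<^sup>+k. shell_mass c l k *
          ennreal_powr (ennreal (P powr (- real_of_int k * (1 - \<beta>))) * ball_integral (radial_operator w f) k) r \<partial>count_space UNIV)
        \<le> (\<integral>\<^sup>+k. (\<integral>\<^sup>+n. ennreal (U powr (r - 1)) * (u n * (shell_mass c l k * ennreal (a k n powr r)))
            \<partial>count_space UNIV) \<partial>count_space UNIV)"
    proof (intro nn_integral_mono)
      fix k
      have "shell_mass c l k *
          ennreal_powr (ennreal (P powr (- real_of_int k * (1 - \<beta>))) * ball_integral (radial_operator w f) k) r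
        \<le> shell_mass c l k * (ennreal (U powr (r - 1)) * (\<integral>\<^sup>+n. u n * ennreal (a k n powr r) \<partial>count_space UNIV))"
        by (rule mult_left_mono[OF pow]) simp
      also have "\<dots> = (\<integral>\<^sup>+n. shell_mass c l k * ennreal (U powr (r - 1)) * (u n * ennreal (a k n powr r)) \<partial>count_space UNIV)"
        by (simp add: nn_integral_cmult mult.assoc)
      finally show "shell_mass c l k *
          ennreal_powr (ennreal (P powr (- real_of_int k * (1 - \<beta>))) * ball_integral (radial_operator w f) k) r
        \<le> (\<integral>\<^sup>+n. ennreal (U powr (r - 1)) * (u n * (shell_mass c l k * ennreal (a k n powr r))) \<partial>count_space UNIV)"
        by (simp add: mult_ac)
    qed
    also have "\<dots> = (\<integral>\<^sup>+n. (\<integral>\<^sup>+k. ennreal (U powr (r - 1)) * (u n * (shell_mass c l k * ennreal (a k n powr r)))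
            \<partial>count_space UNIV) \<partial>count_space UNIV)"
      by (rule nn_integral_count_space_nn_integral) auto
    also have "\<dots> = (\<integral>\<^sup>+n. ennreal (U powr (r - 1)) * (u n * (\<integral>\<^sup>+k. shell_mass c l k * ennreal (a k n powr r)
            \<partial>count_space UNIV)) \<partial>count_space UNIV)"
      by (simp add: nn_integral_cmult)
    also have "\<dots> \<le> (\<integral>\<^sup>+n. ennreal (U powr (r - 1)) * (u n * ?R) \<partial>count_space UNIV)"
      by (intro nn_integral_mono mult_left_mono shifted) auto
    also have "\<dots> = ennreal (U powr (r - 1)) * (ennreal U * ?R)"
      by (simp add: nn_integral_cmult nn_integral_multc sum_u)
    also have "\<dots> = ennreal ((U * N * P powr (real_of_int l * (1 / r - 1 / q))) powr r)"
    proof -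
      have "U powr (r - 1) * U = U powr r" using U(1) by (cases "U = 0") (simp_all add: powr_diff)
      then have "U powr (r - 1) * (U * (N * P powr (real_of_int l * (1 / r - 1 / q))) powr r) =
          (U * N * P powr (real_of_int l * (1 / r - 1 / q))) powr r"
        using U(1) N(1) by (simp only: powr_mult powr_ge_zero mult_nonneg_nonneg mult.assoc[symmetric])
      then show ?thesis using U(1) by (simp only: ennreal_mult'[symmetric] powr_ge_zero)
    qed
    finally show "(\<integral>\<^sup>+k. shell_mass c l k *
          ennreal_powr (ennreal (P powr (- real_of_int k * (1 - \<beta>))) * ball_integral (radial_operator w f) k) r \<partial>count_space UNIV)
        \<le> ennreal ((U * N * P powr (real_of_int l * (1 / r - 1 / q))) powr r)" .
  qed
qed

text \<open>A compact set lies in a ball centred at \<open>0\<close>, over which a function of finite norm is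
  integrable.\<close>

lemma locally_integrable_of_cesaro_morrey_norm:
  assumes "0 < r" and [measurable]: "f \<in> borel_measurable M" and fin: "cesaro_morrey_norm M \<beta> r q f < \<infinity>"
  shows "locally_integrable M f"
  unfolding locally_integrable_def
proof (intro conjI allI impI)
  fix K :: "'p padic set" assume K: "compact K"
  then have [measurable]: "K \<in> sets borel" by (simp add: compact_imp_closed)
  obtain N where N: "0 \<le> N" "cesaro_morrey_norm M \<beta> r q f = ennreal N"
    using fin by (cases "cesaro_morrey_norm M \<beta> r q f") auto
  obtain e where e: "\<And>x. x \<in> K \<Longrightarrow> dist 0 x \<le> e"
    using compact_imp_bounded[OF K] unfolding bounded_any_center[where a=0] by blast
  define k where "k = \<lceil>log P (max e 1)\<rceil>"
  have "max e 1 = P powr log P (max e 1)" using P_gt_1 by simp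
  also have "\<dots> \<le> P powr k" unfolding k_def using P_gt_1 by (intro powr_mono) auto
  finally have ek: "e \<le> P powr k" by simp
  have KB: "K \<subseteq> padic_ball 0 k"
  proof
    fix x assume "x \<in> K"
    then have "padic_norm x \<le> e" using e[of x] by (simp add: dist_padic_def)
    with ek show "x \<in> padic_ball 0 k" by (simp add: padic_ball_powr P_eq)
  qed
  show "set_integrable M K f"
    unfolding set_integrable_def
  proof (rule integrableI_bounded)
    have "(\<integral>\<^sup>+x. ennreal (norm (indicat_real K x *\<^sub>R f x)) \<partial>M) \<le> ball_integral f k"
      unfolding ball_integral_def using KB by (intro nn_integral_mono) (auto simp: indicator_def)
    also have "\<dots> \<le> ennreal (N * P powr (1 / q) * P powr (k * (1 - \<beta> - 1 / q)))"
      by (rule ball_integral_bound[OF assms(1) N(1) eq_refl[OF N(2)]])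
    also have "\<dots> < \<infinity>" by simp
    finally show "(\<integral>\<^sup>+x. ennreal (norm (indicat_real K x *\<^sub>R f x)) \<partial>M) < \<infinity>" .
  qed measurable
qed fact

lemma radial_operator_bounded:
  assumes w: "\<And>n. 0 \<le> w n" and r: "1 \<le> r" and sum: "kernel_sum w (\<beta> + 1 / q) < \<infinity>"
  shows "bounded_on_cesaro_morrey M \<beta> r q (radial_operator w)"
proof -
  obtain U where U: "0 \<le> U" "kernel_sum w (\<beta> + 1 / q) = ennreal U"
    using sum by (cases "kernel_sum w (\<beta> + 1 / q)") auto
  have "radial_operator w f \<in> cesaro_morrey_space M \<beta> r q \<and>
     cesaro_morrey_norm M \<beta> r q (radial_operator w f) \<le> ennreal (U + 1) * cesaro_morrey_norm M \<beta> r q f"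
    if f: "f \<in> cesaro_morrey_space M \<beta> r q" for f
  proof -
    have fm: "f \<in> borel_measurable M" and fin: "cesaro_morrey_norm M \<beta> r q f < \<infinity>"
      using f by (auto simp: cesaro_morrey_space_def locally_integrable_def)
    obtain N where N: "0 \<le> N" "cesaro_morrey_norm M \<beta> r q f = ennreal N"
      using fin by (cases "cesaro_morrey_norm M \<beta> r q f") auto
    have le: "cesaro_morrey_norm M \<beta> r q (radial_operator w f) \<le> ennreal (U * N)"
      by (rule cesaro_morrey_norm_radial_operator_le[OF fm w r N(1) eq_refl[OF N(2)] U])
    also have "\<dots> \<le> ennreal ((U + 1) * N)" using N by (intro ennreal_leI) (simp add: algebra_simps)
    finally have "cesaro_morrey_norm M \<beta> r q (radial_operator w f) \<le> ennreal (U + 1) * cesaro_morrey_norm M \<beta> r q f"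
      using U N by (simp add: ennreal_mult')
    moreover have fin': "cesaro_morrey_norm M \<beta> r q (radial_operator w f) < \<infinity>" using le by (rule le_less_trans) simp
    moreover have "locally_integrable M (radial_operator w f)"
      using r by (intro locally_integrable_of_cesaro_morrey_norm[OF _ _ fin']) auto
    ultimately show ?thesis by (simp add: cesaro_morrey_space_def)
  qed
  \<comment> \<open>The bound must be positive, whereas \<open>U = 0\<close> is possible.\<close>
  then show ?thesis unfolding bounded_on_cesaro_morrey_def using U(1) by (intro exI[of _ "U + 1"]) auto
qed


section \<open>The Hadamard-type kernels\<close>

definition hadamard_weight :: "real \<Rightarrow> real \<Rightarrow> int \<Rightarrow> real" where
  "hadamard_weight \<alpha> \<mu> n = (if 0 < n then P powr (- real_of_int n * \<mu>) * (real_of_int n * ln P) powr (\<alpha> - 1) else 0)"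

lemma hadamard_weight_nonneg [simp]: "0 \<le> hadamard_weight \<alpha> \<mu> n"
  by (simp add: hadamard_weight_def)

lemma kernel_sum_reflect: "kernel_sum (\<lambda>n. w (- n)) \<delta> = kernel_sum w (- \<delta>)"
proof -
  have "(\<integral>\<^sup>+n. ennreal (w (- n) * P powr (- real_of_int n * \<delta>)) \<partial>count_space UNIV) =
      (\<integral>\<^sup>+n. (\<lambda>n. ennreal (w n * P powr (real_of_int n * \<delta>))) (- n) \<partial>count_space UNIV)"
    by simp
  also have "\<dots> = (\<integral>\<^sup>+n. ennreal (w n * P powr (real_of_int n * \<delta>)) \<partial>count_space UNIV)"
    by (intro nn_integral_bij_count_space) (auto intro!: bij_betwI[of _ _ _ uminus])
  finally show ?thesis by (simp add: kernel_sum_def)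
qed

lemma kernel_sum_cmult: "0 \<le> c \<Longrightarrow> kernel_sum (\<lambda>n. c * w n) \<delta> = ennreal c * kernel_sum w \<delta>"
  unfolding kernel_sum_def by (subst nn_integral_cmult[symmetric]) (simp_all add: ennreal_mult' mult.assoc)

text \<open>The terms are those of the series of \<open>(i ln p)\<^sup>\<alpha>\<^sup>-\<^sup>1 p\<^sup>-\<^sup>i\<^sup>(\<^sup>\<mu>\<^sup>+\<^sup>\<delta>\<^sup>)\<close> over \<open>i \<ge> 1\<close>: exponential
  decay beats the power of the logarithm. For the kernels supported on \<open>|t| < |s|\<close> the weight is
  reflected, which replaces \<open>\<delta>\<close> by \<open>- \<delta>\<close>.\<close>

lemma kernel_sum_hadamard_weight:
  assumes "0 < \<mu> + \<delta>"
  shows "kernel_sum (hadamard_weight \<alpha> \<mu>) \<delta> < \<infinity>"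
proof -
  define c where "c = (\<mu> + \<delta>) * ln P"
  have lnP: "0 < ln P" using P_gt_1 by simp
  have c: "0 < c" using assms lnP by (simp add: c_def)
  define g where "g i = (real i * ln P) powr (\<alpha> - 1) * exp (- c * real i)" for i :: nat
  have "(\<lambda>i. (real i * ln P) powr (\<alpha> - 1) * exp (- c * real i)) \<in> O(\<lambda>i. 1 / real i ^ 2)"
    using c lnP by real_asymp
  moreover have "summable (\<lambda>i. norm (1 / real i ^ 2))"
    using inverse_power_summable[of 2, where 'a=real] by (simp add: inverse_eq_divide)
  ultimately have "summable g"
    unfolding g_def by (rule summable_comparison_test_bigo[rotated])
  have g0: "0 \<le> g i" for i unfolding g_def by (intro mult_nonneg_nonneg powr_ge_zero) simp
  have sg: "(\<integral>\<^sup>+i. ennreal (g i) \<partial>count_space UNIV) < \<infinity>"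
    unfolding nn_integral_count_space_nat suminf_ennreal2[OF g0 \<open>summable g\<close>] by simp
  have "kernel_sum (hadamard_weight \<alpha> \<mu>) \<delta> =
      (\<integral>\<^sup>+n. ennreal (hadamard_weight \<alpha> \<mu> n * P powr (- real_of_int n * \<delta>)) \<partial>count_space (int ` UNIV))"
    unfolding kernel_sum_def
    by (intro nn_integral_count_space_eq) (auto simp: hadamard_weight_def image_iff dest: zero_less_imp_eq_int)
  also have "\<dots> = (\<integral>\<^sup>+i. ennreal (hadamard_weight \<alpha> \<mu> (int i) * P powr (- real_of_int (int i) * \<delta>)) \<partial>count_space UNIV)"
    by (intro nn_integral_bij_count_space[symmetric]) (auto simp: bij_betw_def)
  also have "\<dots> \<le> (\<integral>\<^sup>+i. ennreal (g i) \<partial>count_space UNIV)"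
  proof (intro nn_integral_mono ennreal_leI)
    fix i
    show "hadamard_weight \<alpha> \<mu> (int i) * P powr (- real_of_int (int i) * \<delta>) \<le> g i"
    proof (cases "i = 0")
      case False
      let ?L = "(real i * ln P) powr (\<alpha> - 1)"
      have e: "P powr (- real i * \<mu>) * P powr (- real i * \<delta>) = exp (- c * real i)"
        unfolding powr_add[symmetric] using P_gt_1 by (simp add: powr_def c_def algebra_simps)
      have "hadamard_weight \<alpha> \<mu> (int i) * P powr (- real_of_int (int i) * \<delta>) =
          (P powr (- real i * \<mu>) * (real i * ln P) powr (\<alpha> - 1)) * P powr (- real i * \<delta>)"
        using False by (simp add: hadamard_weight_def)
      also have "\<dots> = (P powr (- real i * \<mu>) * P powr (- real i * \<delta>)) * (real i * ln P) powr (\<alpha> - 1)"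
        by (simp only: mult_ac)
      also have "\<dots> = g i" unfolding e g_def by (rule mult.commute)
      finally show ?thesis by simp
    qed (simp add: hadamard_weight_def g_def)
  qed
  finally show ?thesis using sg by (rule le_less_trans)
qed

lemma J_inner_kernel_radial:
  "indicator (inner_region s) t * J_inner_kernel \<alpha> \<mu> s t = radial_kernel (\<lambda>n. hadamard_weight \<alpha> \<mu> (- n)) s t"
proof (cases "s = 0 \<or> t = 0")
  case False
  have "P > 0" using P_gt_1 by simp
  then have q: "padic_norm t / padic_norm s = P powr (padic_log t - padic_log s)"
     "padic_norm s / padic_norm t = P powr (padic_log s - padic_log t)"
    using False by (simp_all add: padic_norm_eq_powr_log P_eq[symmetric] powr_diff)
  have "t \<in> inner_region s \<longleftrightarrow> padic_log t < padic_log s"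
    using False P_gt_1 by (simp add: inner_region_def padic_norm_eq_powr_log P_eq[symmetric])
  then show ?thesis
    unfolding J_inner_kernel_def radial_kernel_def hadamard_weight_def q
    using False P_gt_1 by (simp add: ln_powr powr_powr)
qed (auto simp: inner_region_def radial_kernel_def indicator_def not_less)

lemma J_outer_kernel_radial:
  "indicator (outer_region s) t * J_outer_kernel \<alpha> \<mu> s t = radial_kernel (hadamard_weight \<alpha> \<mu>) s t"
proof (cases "s = 0 \<or> t = 0")
  case False
  have "P > 0" using P_gt_1 by simp
  then have q: "padic_norm t / padic_norm s = P powr (padic_log t - padic_log s)"
     "padic_norm s / padic_norm t = P powr (padic_log s - padic_log t)"
    using False by (simp_all add: padic_norm_eq_powr_log P_eq[symmetric] powr_diff)
  have "t \<in> outer_region s \<longleftrightarrow> padic_log s < padic_log t"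
    using False P_gt_1 by (simp add: outer_region_def padic_norm_eq_powr_log P_eq[symmetric])
  then show ?thesis
    unfolding J_outer_kernel_def radial_kernel_def hadamard_weight_def q
    using False P_gt_1 by (simp add: ln_powr powr_powr)
qed (auto simp: outer_region_def radial_kernel_def J_outer_kernel_def)

text \<open>Trading the factor \<open>1 / |t|\<close> for \<open>1 / |s|\<close> changes the kernel by \<open>|t| / |s|\<close>, that is,
  shifts \<open>\<mu>\<close> by one; the sign of the shift is different for the outer kernel. Hence the
  thresholds for \<open>\<mu>\<close> of the two families of operators differ by one.\<close>

lemma I_inner_kernel_eq:
  assumes "t \<in> inner_region s"
  shows "I_inner_kernel \<alpha> \<mu> s t = J_inner_kernel \<alpha> (\<mu> + 1) s t"
proof -
  have "padic_norm t > 0" "padic_norm s > 0"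
    using assms le_less_trans[OF padic_norm_ge_0] by (auto simp: inner_region_def simp flip: padic_norm_pos_iff)
  then show ?thesis by (simp add: I_inner_kernel_def J_inner_kernel_def powr_add)
qed

lemma I_outer_kernel_eq:
  assumes "t \<in> outer_region s"
  shows "I_outer_kernel \<alpha> \<mu> s t = J_outer_kernel \<alpha> (\<mu> - 1) s t"
proof (cases "s = 0")
  case False
  have "padic_norm t > 0" "padic_norm s > 0"
    using assms False by (simp_all add: outer_region_def)
  then show ?thesis by (simp add: I_outer_kernel_def J_outer_kernel_def powr_diff)
qed (simp add: I_outer_kernel_def J_outer_kernel_def)

lemma radial_integral_operator:
  assumes r: "1 \<le> r" and \<alpha>: "0 < \<alpha>" and w: "\<And>n. 0 \<le> w n" and sum: "kernel_sum w (\<beta> + 1 / q) < \<infinity>"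
    and k: "\<And>s t. indicator (D s) t * k s t = radial_kernel w s t"
    and T: "\<And>f s. T f s = (1 / Gamma \<alpha>) *\<^sub>R (LINT t:D s|M. k s t *\<^sub>R f t)"
  shows "converges_on_cesaro_morrey M \<beta> r q D k \<and> bounded_on_cesaro_morrey M \<beta> r q T"
proof
  have k': "indicat_real (D s) t *\<^sub>R (k s t *\<^sub>R x) = radial_kernel w s t *\<^sub>R x" for s t and x :: complex
    by (simp add: k)
  show "converges_on_cesaro_morrey M \<beta> r q D k"
    unfolding converges_on_cesaro_morrey_def set_integrable_def k'
    using r sum by (auto simp: cesaro_morrey_space_def locally_integrable_def intro!: integrable_radial_kernel[OF _ w])
  define c where "c = 1 / Gamma \<alpha>"
  have c: "0 \<le> c" using Gamma_real_pos[OF \<alpha>] by (simp add: c_def)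
  have "T = radial_operator (\<lambda>n. c * w n)"
  proof (intro ext)
    fix f s
    have "T f s = (LINT t|M. c *\<^sub>R (radial_kernel w s t *\<^sub>R f t))"
      unfolding T set_lebesgue_integral_def k' c_def by (rule integral_scaleR_right[symmetric])
    also have "\<dots> = radial_operator (\<lambda>n. c * w n) f s"
      unfolding radial_operator_def by (intro Bochner_Integration.integral_cong) (auto simp: radial_kernel_def)
    finally show "T f s = \<dots>" .
  qed
  then show "bounded_on_cesaro_morrey M \<beta> r q T"
    using w c sum r by (auto intro!: radial_operator_bounded simp: kernel_sum_cmult ennreal_mult_less_top)
qed

end

theorem theorem20:
  fixes M :: "'p::prime_card padic measure" and r q \<beta> \<alpha> \<mu> :: real
  assumes "padic_haar M"
    and "1 \<le> r" and "r \<le> q" and "0 \<le> \<beta>" and "\<beta> < 1" and "0 < \<alpha>"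
  shows "(\<mu> > \<beta> + 1 / q \<longrightarrow>
           converges_on_cesaro_morrey M \<beta> r q inner_region (J_inner_kernel \<alpha> \<mu>) \<and>
           bounded_on_cesaro_morrey M \<beta> r q (hadamard_J_inner M \<alpha> \<mu>)) \<and>
         (\<mu> > - \<beta> - 1 / q \<longrightarrow>
           converges_on_cesaro_morrey M \<beta> r q outer_region (J_outer_kernel \<alpha> \<mu>) \<and>
           bounded_on_cesaro_morrey M \<beta> r q (hadamard_J_outer M \<alpha> \<mu>)) \<and>
         (\<mu> > \<beta> + 1 / q - 1 \<longrightarrow>
           converges_on_cesaro_morrey M \<beta> r q inner_region (I_inner_kernel \<alpha> \<mu>) \<and>
           bounded_on_cesaro_morrey M \<beta> r q (hadamard_I_inner M \<alpha> \<mu>)) \<and>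
         (\<mu> > 1 - \<beta> - 1 / q \<longrightarrow>
           converges_on_cesaro_morrey M \<beta> r q outer_region (I_outer_kernel \<alpha> \<mu>) \<and>
           bounded_on_cesaro_morrey M \<beta> r q (hadamard_I_outer M \<alpha> \<mu>))"
proof -
  interpret padic_haar_measure M "real CARD('p)"
    by unfold_locales (simp_all add: assms(1))
  have inner: "indicator (inner_region s) t * I_inner_kernel \<alpha> \<mu> s t =
      radial_kernel (\<lambda>n. hadamard_weight \<alpha> (\<mu> + 1) (- n)) s t" for s t
    unfolding J_inner_kernel_radial[symmetric] by (simp add: indicator_def I_inner_kernel_eq)
  have outer: "indicator (outer_region s) t * I_outer_kernel \<alpha> \<mu> s t =
      radial_kernel (hadamard_weight \<alpha> (\<mu> - 1)) s t" for s t
    unfolding J_outer_kernel_radial[symmetric] by (simp add: indicator_def I_outer_kernel_eq)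
  show ?thesis
  proof (intro conjI[of "_ \<longrightarrow> _"] impI)
    assume "\<mu> > \<beta> + 1 / q"
    then have "kernel_sum (\<lambda>n. hadamard_weight \<alpha> \<mu> (- n)) (\<beta> + 1 / q) < \<infinity>"
      unfolding kernel_sum_reflect by (intro kernel_sum_hadamard_weight) simp
    then show "converges_on_cesaro_morrey M \<beta> r q inner_region (J_inner_kernel \<alpha> \<mu>) \<and>
           bounded_on_cesaro_morrey M \<beta> r q (hadamard_J_inner M \<alpha> \<mu>)"
      by (rule radial_integral_operator[OF assms(2,6) hadamard_weight_nonneg _ J_inner_kernel_radial hadamard_J_inner_def])
  next
    assume "\<mu> > - \<beta> - 1 / q"
    then have "kernel_sum (hadamard_weight \<alpha> \<mu>) (\<beta> + 1 / q) < \<infinity>"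
      by (intro kernel_sum_hadamard_weight) simp
    then show "converges_on_cesaro_morrey M \<beta> r q outer_region (J_outer_kernel \<alpha> \<mu>) \<and>
           bounded_on_cesaro_morrey M \<beta> r q (hadamard_J_outer M \<alpha> \<mu>)"
      by (rule radial_integral_operator[OF assms(2,6) hadamard_weight_nonneg _ J_outer_kernel_radial hadamard_J_outer_def])
  next
    assume "\<mu> > \<beta> + 1 / q - 1"
    then have "kernel_sum (\<lambda>n. hadamard_weight \<alpha> (\<mu> + 1) (- n)) (\<beta> + 1 / q) < \<infinity>"
      unfolding kernel_sum_reflect by (intro kernel_sum_hadamard_weight) simp
    then show "converges_on_cesaro_morrey M \<beta> r q inner_region (I_inner_kernel \<alpha> \<mu>) \<and>
           bounded_on_cesaro_morrey M \<beta> r q (hadamard_I_inner M \<alpha> \<mu>)"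
      by (rule radial_integral_operator[OF assms(2,6) hadamard_weight_nonneg _ inner hadamard_I_inner_def])
  next
    assume "\<mu> > 1 - \<beta> - 1 / q"
    then have "kernel_sum (hadamard_weight \<alpha> (\<mu> - 1)) (\<beta> + 1 / q) < \<infinity>"
      by (intro kernel_sum_hadamard_weight) simp
    then show "converges_on_cesaro_morrey M \<beta> r q outer_region (I_outer_kernel \<alpha> \<mu>) \<and>
           bounded_on_cesaro_morrey M \<beta> r q (hadamard_I_outer M \<alpha> \<mu>)"
      by (rule radial_integral_operator[OF assms(2,6) hadamard_weight_nonneg _ outer hadamard_I_outer_def])
  qed
qed

end
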